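(* Let $(\Omega,\mathcal{H},\hat{\mathbb{E}})$ be a sublinear expectation space and let $\{X_k\}_{k\ge 1}\subset\mathcal{H}^d$ be a $d$-dimensional stationary sequence which is $\alpha$-mixing for some $\alpha>0$ and satisfies $\hat{\mathbb{E}}[|X_1|^2]<\infty$. Let $$\Gamma_n:=\Big\{\frac1n\sum_{k=1}^n\mathbb{E}[X_k]:\ \mathbb{E}\in\Theta\Big\}\subset\mathbb{R}^d,\qquad \Gamma_*:=\bigcap_{n\ge1}\Gamma_n .$$ Then for any $\delta>0$ there exists $C>0$ such that for every $\phi\in C_{lip}(\mathbb{R}^d)$ with Lipschitz constant $l_\phi>0$ and for all $n\in\mathbb{N}$, $$\Big|\hat{\mathbb{E}}\Big[\phi\Big(\frac1n\sum_{k=1}^nX_k\Big)\Big]-\max_{x\in\Gamma_*}\phi(x)\Big|\le C\,l_\phi\,n^{-1/4+\delta}.$$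
   Context: $\Omega$ is a nonempty set and $\mathcal{H}$ is a linear space of real-valued functions on $\Omega$ that contains the constants, contains $|X|$ whenever it contains $X$ (a vector lattice), and contains $\phi(X_1,\dots,X_n)$ for all $X_1,\dots,X_n\in\mathcal{H}$ and $\phi\in C_{lip}(\mathbb{R}^n)$ (Lipschitz functions $\mathbb{R}^n\to\mathbb{R}$). A sublinear expectation is a functional $\hat{\mathbb{E}}:\mathcal{H}\to\mathbb{R}$ that is monotone ($X\le Y\Rightarrow\hat{\mathbb{E}}[X]\le\hat{\mathbb{E}}[Y]$), preserves constants, is sub-additive, and is positively homogeneous; it is a linear expectation if it is moreover linear. $\Theta$ is the set of all linear expectations $\mathbb{E}$ on $\mathcal{H}$ with $\mathbb{E}[X]\le\hat{\mathbb{E}}[X]$ for all $X\in\mathcal{H}$. For $X=(X^1,\dots,X^d)\in\mathcal{H}^d$, $\mathbb{E}[X]:=(\mathbb{E}[X^1],\dots,\mathbb{E}[X^d])$ and $|X|:=\sum_i|X^i|$. Writing $\hat{\mathbb{E}}[|X_1|^2]<\infty$ presupposes $|X_1|^2\in\mathcal{H}$. Stationary: for all $n\ge1$ and indices $t,t_1,\dots,t_n\in\mathbb{N}$, $(X_{t_1},\dots,X_{t_n})$ and $(X_{t+t_1},\dots,X_{t+t_n})$ are identically distributed, i.e. $\hat{\mathbb{E}}[\psi(\cdot)]$ takes the same value on both for every Lipschitz $\psi$. $\alpha$-mixing (for a given $\alpha>0$): there exists $c_X>0$ such that for all nonempty finite $\Lambda^1,\Lambda^2\subset\mathbb{N}$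 with $\max\Lambda^1\le\min\Lambda^2$ and all $\phi\in C_{lip}(\mathbb{R}^{2d})$ with Lipschitz constant $l_\phi>0$, $$\big|\hat{\mathbb{E}}[\phi(\bar X_{\Lambda^1},\bar X_{\Lambda^2})]-\hat{\mathbb{E}}\big[\hat{\mathbb{E}}[\phi(x,\bar X_{\Lambda^2})]|_{x=\bar X_{\Lambda^1}}\big]\big|\le c_Xl_\phi e^{-\alpha|\min\Lambda^2-\max\Lambda^1|},$$ where $\bar X_{\Lambda}=\frac1{|\Lambda|}\sum_{u\in\Lambda}X_u$. *)

theory Defs
  imports "HOL-Analysis.Analysis"
begin

text \<open>
  Points of \<open>R^d\<close> carry the sum norm throughout, both for \<open>|X|\<close> and for Lipschitz constants.
\<close>

definition norm1 :: "real ^ 'd \<Rightarrow> real"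
  where "norm1 x = (\<Sum>i\<in>UNIV. \<bar>x $ i\<bar>)"

definition lipschitz_wrt :: "('a \<Rightarrow> 'a \<Rightarrow> real) \<Rightarrow> real \<Rightarrow> ('a \<Rightarrow> real) \<Rightarrow> bool"
  where "lipschitz_wrt D L f \<longleftrightarrow> (\<forall>x y. \<bar>f x - f y\<bar> \<le> L * D x y)"

text \<open>
  Functions on \<open>R^n\<close> and \<open>(R^d)^n\<close> with \<open>n\<close> a bound variable are represented by functions on
  sequences that are Lipschitz in the entries \<open>0, ..., n - 1\<close>.  The Lipschitz bound forces such a
  function to ignore all remaining entries.
\<close>

definition dist_Rn :: "nat \<Rightarrow> (nat \<Rightarrow> real) \<Rightarrow> (nat \<Rightarrow> real) \<Rightarrow> real"
  where "dist_Rn n x y = (\<Sum>i<n. \<bar>x i - y i\<bar>)"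

definition dist_Rdn :: "nat \<Rightarrow> (nat \<Rightarrow> real ^ 'd) \<Rightarrow> (nat \<Rightarrow> real ^ 'd) \<Rightarrow> real"
  where "dist_Rdn n x y = (\<Sum>i<n. norm1 (x i - y i))"

definition dist_Rd :: "real ^ 'd \<Rightarrow> real ^ 'd \<Rightarrow> real"
  where "dist_Rd x y = norm1 (x - y)"

definition dist_R2d :: "(real ^ 'd) \<times> (real ^ 'd) \<Rightarrow> (real ^ 'd) \<times> (real ^ 'd) \<Rightarrow> real"
  where "dist_R2d x y = norm1 (fst x - fst y) + norm1 (snd x - snd y)"

locale random_variable_space =
  fixes H :: "('w \<Rightarrow> real) set"
  assumes const_mem: "(\<lambda>_. c) \<in> H"
    and add_mem: "X \<in> H \<Longrightarrow> Y \<in> H \<Longrightarrow> (\<lambda>\<omega>. X \<omega> + Y \<omega>) \<in> H"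
    and scale_mem: "X \<in> H \<Longrightarrow> (\<lambda>\<omega>. c * X \<omega>) \<in> H"
    and abs_mem: "X \<in> H \<Longrightarrow> (\<lambda>\<omega>. \<bar>X \<omega>\<bar>) \<in> H"
    and lipschitz_mem:
      "(\<And>i. i < n \<Longrightarrow> Z i \<in> H) \<Longrightarrow> lipschitz_wrt (dist_Rn n) L \<phi> \<Longrightarrow> (\<lambda>\<omega>. \<phi> (\<lambda>i. Z i \<omega>)) \<in> H"

text \<open>
  A functional on \<open>H\<close> is a total HOL function of which only the values on \<open>H\<close> are constrained
  or used.
\<close>

locale sublinear_expectation = random_variable_space H
  for H :: "('w \<Rightarrow> real) set" +
  fixes E :: "('w \<Rightarrow> real) \<Rightarrow> real"
  assumes mono: "X \<in> H \<Longrightarrow> Y \<in> H \<Longrightarrow> (\<forall>\<omega>. X \<omega> \<le> Y \<omega>) \<Longrightarrow> E X \<le> E Y"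
    and const: "E (\<lambda>_. c) = c"
    and subadditive: "X \<in> H \<Longrightarrow> Y \<in> H \<Longrightarrow> E (\<lambda>\<omega>. X \<omega> + Y \<omega>) \<le> E X + E Y"
    and pos_homogeneous: "X \<in> H \<Longrightarrow> c \<ge> 0 \<Longrightarrow> E (\<lambda>\<omega>. c * X \<omega>) = c * E X"

locale linear_expectation = sublinear_expectation H E
  for H :: "('w \<Rightarrow> real) set" and E :: "('w \<Rightarrow> real) \<Rightarrow> real" +
  assumes linear: "X \<in> H \<Longrightarrow> Y \<in> H \<Longrightarrow> E (\<lambda>\<omega>. a * X \<omega> + b * Y \<omega>) = a * E X + b * E Y"

definition dominated_linear_expectations ::
    "('w \<Rightarrow> real) set \<Rightarrow> (('w \<Rightarrow> real) \<Rightarrow> real) \<Rightarrow> (('w \<Rightarrow> real) \<Rightarrow> real) set"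
  where "dominated_linear_expectations H Ehat =
    {E. linear_expectation H E \<and> (\<forall>X\<in>H. E X \<le> Ehat X)}"

definition vec_expectation :: "(('w \<Rightarrow> real) \<Rightarrow> real) \<Rightarrow> ('w \<Rightarrow> real ^ 'd) \<Rightarrow> real ^ 'd"
  where "vec_expectation E X = (\<chi> i. E (\<lambda>\<omega>. X \<omega> $ i))"

definition random_vectors :: "('w \<Rightarrow> real) set \<Rightarrow> ('w \<Rightarrow> real ^ 'd) set"
  where "random_vectors H = {X. \<forall>i. (\<lambda>\<omega>. X \<omega> $ i) \<in> H}"

definition identically_distributed ::
    "(('w \<Rightarrow> real) \<Rightarrow> real) \<Rightarrow> nat \<Rightarrow> (nat \<Rightarrow> 'w \<Rightarrow> real ^ 'd) \<Rightarrow> (nat \<Rightarrow> 'w \<Rightarrow> real ^ 'd) \<Rightarrow> bool"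
  where "identically_distributed Ehat n Y Z \<longleftrightarrow>
    (\<forall>\<psi> L. lipschitz_wrt (dist_Rdn n) L \<psi> \<longrightarrow>
      Ehat (\<lambda>\<omega>. \<psi> (\<lambda>i. Y i \<omega>)) = Ehat (\<lambda>\<omega>. \<psi> (\<lambda>i. Z i \<omega>)))"

text \<open>Sequences are indexed by the positive integers; the value \<open>X 0\<close> is never used.\<close>

definition stationary :: "(('w \<Rightarrow> real) \<Rightarrow> real) \<Rightarrow> (nat \<Rightarrow> 'w \<Rightarrow> real ^ 'd) \<Rightarrow> bool"
  where "stationary Ehat X \<longleftrightarrow>
    (\<forall>n\<ge>1. \<forall>t\<ge>1. \<forall>\<tau>. (\<forall>i<n. \<tau> i \<ge> 1) \<longrightarrow>
      identically_distributed Ehat n (\<lambda>i. X (\<tau> i)) (\<lambda>i. X (t + \<tau> i)))"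

definition block_mean :: "(nat \<Rightarrow> 'w \<Rightarrow> real ^ 'd) \<Rightarrow> nat set \<Rightarrow> 'w \<Rightarrow> real ^ 'd"
  where "block_mean X \<Lambda> \<omega> = (1 / real (card \<Lambda>)) *\<^sub>R (\<Sum>u\<in>\<Lambda>. X u \<omega>)"

definition alpha_mixing ::
    "(('w \<Rightarrow> real) \<Rightarrow> real) \<Rightarrow> real \<Rightarrow> (nat \<Rightarrow> 'w \<Rightarrow> real ^ 'd) \<Rightarrow> bool"
  where "alpha_mixing Ehat \<alpha> X \<longleftrightarrow>
    (\<exists>c>0. \<forall>\<Lambda>\<^sub>1 \<Lambda>\<^sub>2. finite \<Lambda>\<^sub>1 \<and> \<Lambda>\<^sub>1 \<noteq> {} \<and> \<Lambda>\<^sub>1 \<subseteq> {1..} \<and>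
        finite \<Lambda>\<^sub>2 \<and> \<Lambda>\<^sub>2 \<noteq> {} \<and> \<Lambda>\<^sub>2 \<subseteq> {1..} \<and> Max \<Lambda>\<^sub>1 \<le> Min \<Lambda>\<^sub>2 \<longrightarrow>
      (\<forall>\<phi> l. l > 0 \<and> lipschitz_wrt dist_R2d l \<phi> \<longrightarrow>
        \<bar>Ehat (\<lambda>\<omega>. \<phi> (block_mean X \<Lambda>\<^sub>1 \<omega>, block_mean X \<Lambda>\<^sub>2 \<omega>))
          - Ehat (\<lambda>\<omega>. Ehat (\<lambda>\<omega>'. \<phi> (block_mean X \<Lambda>\<^sub>1 \<omega>, block_mean X \<Lambda>\<^sub>2 \<omega>')))\<bar>
        \<le> c * l * exp (- \<alpha> * \<bar>real (Min \<Lambda>\<^sub>2) - real (Max \<Lambda>\<^sub>1)\<bar>)))"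

definition mean_set ::
    "('w \<Rightarrow> real) set \<Rightarrow> (('w \<Rightarrow> real) \<Rightarrow> real) \<Rightarrow> (nat \<Rightarrow> 'w \<Rightarrow> real ^ 'd) \<Rightarrow> nat \<Rightarrow> (real ^ 'd) set"
  where "mean_set H Ehat X n =
    {(1 / real n) *\<^sub>R (\<Sum>k=1..n. vec_expectation E (X k)) | E.
      E \<in> dominated_linear_expectations H Ehat}"

definition limit_mean_set ::
    "('w \<Rightarrow> real) set \<Rightarrow> (('w \<Rightarrow> real) \<Rightarrow> real) \<Rightarrow> (nat \<Rightarrow> 'w \<Rightarrow> real ^ 'd) \<Rightarrow> (real ^ 'd) set"
  where "limit_mean_set H Ehat X = (\<Inter>n\<in>{1..}. mean_set H Ehat X n)"

text \<open>
  The library's \<open>Max\<close> is meant for finite sets and \<open>Sup\<close> on the reals is unspecified for the empty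
  set, so the maximum is a relation, which includes its existence.
\<close>

definition is_max_over :: "('a \<Rightarrow> real) \<Rightarrow> 'a set \<Rightarrow> real \<Rightarrow> bool"
  where "is_max_over f S m \<longleftrightarrow> (\<exists>x\<in>S. f x = m) \<and> (\<forall>y\<in>S. f y \<le> m)"

end

theory Submission
  imports Defs
begin

text \<open>
  Write \<open>g\<^sub>m v = E [v \<bullet> M\<^sub>m]\<close> for the mean \<open>M\<^sub>m\<close> of \<open>m\<close> consecutive terms. By Hahn-Banach, the mean set
  \<open>\<Gamma>\<^sub>m\<close> is the compact convex set with support function \<open>g\<^sub>m\<close>. Mixing gives
  \<open>\<bar>g\<^bsub>2m\<^esub> - g\<^sub>m\<bar> = O (m^(-1/2))\<close> and stationarity gives subadditivity, so the support function of the
  intersection \<open>K\<close> of all mean sets lies within \<open>O (m^(-1/2))\<close> of \<open>g\<^sub>m\<close>.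

  Split \<open>n\<close> terms into \<open>N\<close> blocks of length \<open>m\<close> separated by gaps. Up to an exponentially small error,
  the sum of the block means behaves as if the blocks were independent, i.e. it is governed by the
  iterates of \<open>P G z = E [G (z + M\<^sub>m)]\<close>. Along these iterates the functions
  \<open>sqrt (s\<^sup>2 + dist (x, j K)\<^sup>2)\<close> grow by only \<open>O (1 / s + m^(-1/2))\<close> per step, which bounds the expectation from
  above, and \<open>- sqrt (s\<^sup>2 + \<bar>x - j y\<bar>\<^sup>2)\<close> with \<open>y\<close> a maximiser on \<open>K\<close> decreases by only \<open>O (1 / s)\<close>, which
  bounds it from below. The choices \<open>m \<approx> N \<approx> n^(1/2)\<close> and \<open>s\<close>, gap \<open>\<approx> n^(1/4)\<close> yield the rate
  \<open>n^(-1/4)\<close> with a constant that does not depend on \<open>\<delta>\<close>.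
\<close>

subsection \<open>Dominated linear functionals\<close>

context random_variable_space
begin

lemma zero_mem: "(\<lambda>_. 0) \<in> H"
  by (rule const_mem)

lemma uminus_mem: "X \<in> H \<Longrightarrow> (\<lambda>\<omega>. - X \<omega>) \<in> H"
  using scale_mem[of X "-1"] by simp

lemma diff_mem: "X \<in> H \<Longrightarrow> Y \<in> H \<Longrightarrow> (\<lambda>\<omega>. X \<omega> - Y \<omega>) \<in> H"
  using add_mem[of X "\<lambda>\<omega>. - Y \<omega>"] uminus_mem by simp

lemma sum_mem: "(\<And>i. i \<in> I \<Longrightarrow> Z i \<in> H) \<Longrightarrow> (\<lambda>\<omega>. \<Sum>i\<in>I. Z i \<omega>) \<in> H"
  by (induction I rule: infinite_finite_induct) (auto intro: add_mem zero_mem)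

text \<open>The linear-structure half of a sublinear expectation, which is preserved by infimal
  convolutions and by infima of chains. Monotonicity and the values at constants are recovered once
  a linear functional lies below an expectation.\<close>

definition sublinear_functional :: "(('w \<Rightarrow> real) \<Rightarrow> real) \<Rightarrow> bool"
  where "sublinear_functional p \<longleftrightarrow>
    (\<forall>X\<in>H. \<forall>Y\<in>H. p (\<lambda>\<omega>. X \<omega> + Y \<omega>) \<le> p X + p Y) \<and>
    (\<forall>X\<in>H. \<forall>c\<ge>0. p (\<lambda>\<omega>. c * X \<omega>) = c * p X)"

text \<open>One inequality suffices for homogeneity: applied to \<open>c * X\<close> with the factor
  \<open>1 / c\<close> it gives the converse, and \<open>c = 0\<close> is the value at zero.\<close>

lemma sublinear_functionalI:
  assumes add: "\<And>X Y. X \<in> H \<Longrightarrow> Y \<in> H \<Longrightarrow> p (\<lambda>\<omega>. X \<omega> + Y \<omega>) \<le> p X + p Y"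
    and zero: "p (\<lambda>_. 0) = 0"
    and scale: "\<And>X c. X \<in> H \<Longrightarrow> c > 0 \<Longrightarrow> p (\<lambda>\<omega>. c * X \<omega>) \<le> c * p X"
  shows "sublinear_functional p"
proof -
  have "p (\<lambda>\<omega>. c * X \<omega>) = c * p X" if X: "X \<in> H" and c: "c \<ge> 0" for X c
  proof (cases "c = 0")
    case True
    then show ?thesis using zero by simp
  next
    case False
    with c have c: "c > 0" by simp
    have "p (\<lambda>\<omega>. (1/c) * (c * X \<omega>)) \<le> (1/c) * p (\<lambda>\<omega>. c * X \<omega>)"
      by (rule scale[OF scale_mem[OF X]]) (use c in simp)
    also have "(\<lambda>\<omega>. (1/c) * (c * X \<omega>)) = X"
      using c by auto
    finally have "c * p X \<le> p (\<lambda>\<omega>. c * X \<omega>)"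
      using c by (simp add: field_simps)
    with scale[OF X c] show ?thesis by simp
  qed
  with add show ?thesis
    by (simp add: sublinear_functional_def)
qed

lemma sublinear_functional_add:
  "sublinear_functional p \<Longrightarrow> X \<in> H \<Longrightarrow> Y \<in> H \<Longrightarrow> p (\<lambda>\<omega>. X \<omega> + Y \<omega>) \<le> p X + p Y"
  by (simp add: sublinear_functional_def)

lemma sublinear_functional_scale:
  "sublinear_functional p \<Longrightarrow> X \<in> H \<Longrightarrow> c \<ge> 0 \<Longrightarrow> p (\<lambda>\<omega>. c * X \<omega>) = c * p X"
  by (simp add: sublinear_functional_def)

lemma sublinear_functional_zero: "sublinear_functional p \<Longrightarrow> p (\<lambda>_. 0) = 0"
  using sublinear_functional_scale[of p "\<lambda>_. 0" 0] zero_mem by simp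

lemma sublinear_functional_uminus:
  assumes "sublinear_functional p" "X \<in> H"
  shows "- p (\<lambda>\<omega>. - X \<omega>) \<le> p X"
  using sublinear_functional_add[OF assms uminus_mem[OF assms(2)]]
    sublinear_functional_zero[OF assms(1)] by simp

text \<open>
  The infimal convolution of \<open>p\<close> with the constraints \<open>q Y \<le> b\<close>; the hypothesis \<open>bound\<close> says that
  no single constraint contradicts \<open>p\<close>.
\<close>

lemma sublinear_functional_restrict:
  fixes C :: "(('w \<Rightarrow> real) \<times> real) set"
  assumes p: "sublinear_functional p"
    and mem: "\<And>Y b. (Y, b) \<in> C \<Longrightarrow> Y \<in> H"
    and zero: "((\<lambda>_. 0), 0) \<in> C"
    and add: "\<And>Y b Y' b'. (Y, b) \<in> C \<Longrightarrow> (Y', b') \<in> C \<Longrightarrow> ((\<lambda>\<omega>. Y \<omega> + Y' \<omega>), b + b') \<in> C"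
    and scale: "\<And>Y b c. (Y, b) \<in> C \<Longrightarrow> c > 0 \<Longrightarrow> ((\<lambda>\<omega>. c * Y \<omega>), c * b) \<in> C"
    and bound: "\<And>Y b. (Y, b) \<in> C \<Longrightarrow> - p (\<lambda>\<omega>. - Y \<omega>) \<le> b"
  obtains q where "sublinear_functional q" "\<And>X. X \<in> H \<Longrightarrow> q X \<le> p X"
    "\<And>Y b. (Y, b) \<in> C \<Longrightarrow> q Y \<le> b"
proof
  define f where "f = (\<lambda>Z (Y, b). p (\<lambda>\<omega>. Z \<omega> - Y \<omega>) + b)"
  define q where "q = (\<lambda>Z. INF c\<in>C. f Z c)"
  \<comment> \<open>The infimum defining \<open>q\<close> is finite: splitting \<open>- Y\<close>
    into \<open>Z - Y\<close> and \<open>- Z\<close> bounds every term from below by a quantity free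
    of the constraint.\<close>
  have lower: "- p (\<lambda>\<omega>. - Z \<omega>) \<le> f Z c" if Z: "Z \<in> H" and c: "c \<in> C" for Z c
  proof -
    obtain Y b where [simp]: "c = (Y, b)" by (cases c)
    have Y: "Y \<in> H" using mem c by simp
    have "p (\<lambda>\<omega>. - Y \<omega>) \<le> p (\<lambda>\<omega>. Z \<omega> - Y \<omega>) + p (\<lambda>\<omega>. - Z \<omega>)"
      using sublinear_functional_add[OF p diff_mem[OF Z Y] uminus_mem[OF Z]] by simp
    with bound[of Y b] c show ?thesis by (simp add: f_def)
  qed
  have bdd: "bdd_below (f Z ` C)" if "Z \<in> H" for Z
    using lower[OF that] by (intro bdd_belowI2)
  have qle: "q Z \<le> p (\<lambda>\<omega>. Z \<omega> - Y \<omega>) + b" if "Z \<in> H" "(Y, b) \<in> C" for Z Y b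
    using cINF_lower[OF bdd[OF that(1)] that(2)] by (simp add: q_def f_def)
  have qge: "a \<le> q Z" if "\<And>Y b. (Y, b) \<in> C \<Longrightarrow> a \<le> p (\<lambda>\<omega>. Z \<omega> - Y \<omega>) + b" for a Z
    unfolding q_def using zero that by (intro cINF_greatest) (auto simp: f_def)
  show le: "q X \<le> p X" if "X \<in> H" for X
    using qle[OF that zero] by simp
  show "q Y \<le> b" if "(Y, b) \<in> C" for Y b
    using qle[OF mem[OF that] that] sublinear_functional_zero[OF p] by simp
  show "sublinear_functional q"
  proof (rule sublinear_functionalI)
    fix X Y assume X: "X \<in> H" and Y: "Y \<in> H"
    have *: "q (\<lambda>\<omega>. X \<omega> + Y \<omega>) \<le> (p (\<lambda>\<omega>. X \<omega> - V \<omega>) + b) + (p (\<lambda>\<omega>. Y \<omega> - W \<omega>) + d)"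
      if V: "(V, b) \<in> C" and W: "(W, d) \<in> C" for V b W d
    proof -
      have "q (\<lambda>\<omega>. X \<omega> + Y \<omega>) \<le> p (\<lambda>\<omega>. (X \<omega> - V \<omega>) + (Y \<omega> - W \<omega>)) + (b + d)"
        using qle[OF add_mem[OF X Y] add[OF V W]] by (simp add: algebra_simps)
      also have "\<dots> \<le> p (\<lambda>\<omega>. X \<omega> - V \<omega>) + p (\<lambda>\<omega>. Y \<omega> - W \<omega>) + (b + d)"
        using sublinear_functional_add[OF p diff_mem[OF X mem[OF V]] diff_mem[OF Y mem[OF W]]]
        by simp
      finally show ?thesis by simp
    qed
    \<comment> \<open>The infima on the right are taken one after the other, first over
      \<open>(W, d)\<close> and then over \<open>(V, b)\<close>.\<close>
    have "q (\<lambda>\<omega>. X \<omega> + Y \<omega>) - (p (\<lambda>\<omega>. X \<omega> - V \<omega>) + b) \<le> q Y" if V: "(V, b) \<in> C" for V b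
      by (rule qge) (use *[OF V] in \<open>simp add: algebra_simps\<close>)
    then have "q (\<lambda>\<omega>. X \<omega> + Y \<omega>) - q Y \<le> q X"
      by (intro qge) (simp add: algebra_simps)
    then show "q (\<lambda>\<omega>. X \<omega> + Y \<omega>) \<le> q X + q Y"
      by simp
  next
    have "0 \<le> q (\<lambda>_. 0)"
      by (rule qge) (use bound in \<open>simp add: algebra_simps\<close>, force)
    with le[OF zero_mem] sublinear_functional_zero[OF p] show "q (\<lambda>_. 0) = 0"
      by simp
  next
    fix X and c :: real assume X: "X \<in> H" and c: "c > 0"
    have "q (\<lambda>\<omega>. c * X \<omega>) / c \<le> q X"
    proof (rule qge)
      fix Y b assume Y: "(Y, b) \<in> C"
      have "q (\<lambda>\<omega>. c * X \<omega>) \<le> p (\<lambda>\<omega>. c * (X \<omega> - Y \<omega>)) + c * b"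
        using qle[OF scale_mem[OF X] scale[OF Y c]] by (simp add: algebra_simps)
      also have "\<dots> = c * (p (\<lambda>\<omega>. X \<omega> - Y \<omega>) + b)"
        using sublinear_functional_scale[OF p diff_mem[OF X mem[OF Y]], of c] c
        by (simp add: algebra_simps)
      finally show "q (\<lambda>\<omega>. c * X \<omega>) / c \<le> p (\<lambda>\<omega>. X \<omega> - Y \<omega>) + b"
        using c by (simp add: field_simps)
    qed
    then show "q (\<lambda>\<omega>. c * X \<omega>) \<le> c * q X"
      using c by (simp add: field_simps)
  qed
qed

text \<open>
  Zorn's lemma on functionals that vanish outside \<open>H\<close>, which makes the pointwise order
  antisymmetric.
\<close>

lemma minimal_sublinear_functional:
  assumes p: "sublinear_functional p"
  obtains q where "sublinear_functional q" "\<And>X. X \<in> H \<Longrightarrow> q X \<le> p X"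
    "\<And>r. sublinear_functional r \<Longrightarrow> (\<And>X. X \<in> H \<Longrightarrow> r X \<le> q X) \<Longrightarrow> (\<And>X. X \<in> H \<Longrightarrow> r X = q X)"
proof -
  define cut where "cut = (\<lambda>(q :: ('w \<Rightarrow> real) \<Rightarrow> real) X. if X \<in> H then q X else 0)"
  have cut: "sublinear_functional (cut q) \<longleftrightarrow> sublinear_functional q" for q
    by (simp add: sublinear_functional_def cut_def add_mem scale_mem)
  define A where "A = {q. sublinear_functional q \<and> (\<forall>X\<in>H. q X \<le> p X) \<and> (\<forall>X. X \<notin> H \<longrightarrow> q X = 0)}"
  define R where "R = (\<lambda>q r :: ('w \<Rightarrow> real) \<Rightarrow> real. r \<le> q)"
  have "\<exists>q\<in>A. \<forall>r\<in>A. R q r \<longrightarrow> r = q"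
  proof (rule predicate_Zorn)
    show "partial_order_on A (relation_of R A)"
      by (rule partial_order_on_relation_ofI) (auto simp: R_def)
  next
    fix C assume "C \<in> Chains (relation_of R A)"
    then have CA: "C \<subseteq> A" and chain: "\<And>q r. q \<in> C \<Longrightarrow> r \<in> C \<Longrightarrow> q \<le> r \<or> r \<le> q"
      by (auto simp: Chains_def relation_of_def R_def)
    show "\<exists>u\<in>A. \<forall>q\<in>C. R q u"
    proof (cases "C = {}")
      case True
      have "cut p \<in> A"
        using p cut by (auto simp: A_def cut_def)
      then show ?thesis using True by blast
    next
      case False
      define u where "u = cut (\<lambda>X. INF q\<in>C. q X)"
      have sub: "sublinear_functional q" and le: "\<And>X. X \<in> H \<Longrightarrow> q X \<le> p X"
        and out: "\<And>X. X \<notin> H \<Longrightarrow> q X = 0" if "q \<in> C" for q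
        using CA that by (auto simp: A_def)
      have "bdd_below ((\<lambda>q. q X) ` C)" if X: "X \<in> H" for X
      proof (rule bdd_belowI2)
        fix q assume q: "q \<in> C"
        show "- p (\<lambda>\<omega>. - X \<omega>) \<le> q X"
          using sublinear_functional_uminus[OF sub[OF q] X] le[OF q uminus_mem[OF X]] by simp
      qed
      then have ule: "u X \<le> q X" if "X \<in> H" "q \<in> C" for X q
        using that by (auto simp: u_def cut_def intro: cINF_lower)
      have uge: "a \<le> u X" if "X \<in> H" "\<And>q. q \<in> C \<Longrightarrow> a \<le> q X" for a X
        using that False by (auto simp: u_def cut_def intro: cINF_greatest)
      have "sublinear_functional u"
      proof (rule sublinear_functionalI)
        fix X Y assume X: "X \<in> H" and Y: "Y \<in> H"
        have *: "u (\<lambda>\<omega>. X \<omega> + Y \<omega>) \<le> q X + r Y" if qr: "q \<in> C" "r \<in> C" for q r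
        proof -
          \<comment> \<open>Subadditivity is available for one functional at a time; in a chain the
            smaller of \<open>q\<close> and \<open>r\<close> serves for both.\<close>
          obtain s where s: "s \<in> C" "s \<le> q" "s \<le> r"
            using chain[OF qr] qr by blast
          have "u (\<lambda>\<omega>. X \<omega> + Y \<omega>) \<le> s X + s Y"
            using ule[OF add_mem[OF X Y] s(1)] sublinear_functional_add[OF sub[OF s(1)] X Y] by simp
          also have "\<dots> \<le> q X + r Y"
            using s by (intro add_mono) (auto simp: le_fun_def)
          finally show ?thesis .
        qed
        have "u (\<lambda>\<omega>. X \<omega> + Y \<omega>) - q X \<le> u Y" if "q \<in> C" for q
          by (rule uge[OF Y]) (use *[OF that] in \<open>simp add: algebra_simps\<close>)
        then have "u (\<lambda>\<omega>. X \<omega> + Y \<omega>) - u Y \<le> u X"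
          by (intro uge[OF X]) (simp add: algebra_simps)
        then show "u (\<lambda>\<omega>. X \<omega> + Y \<omega>) \<le> u X + u Y" by simp
      next
        have "(INF q\<in>C. q (\<lambda>_. 0)) = (INF q\<in>C. (0::real))"
          using sublinear_functional_zero[OF sub] by (intro INF_cong) auto
        then show "u (\<lambda>_. 0) = 0"
          using False zero_mem by (simp add: u_def cut_def)
      next
        fix X and c :: real assume X: "X \<in> H" and c: "c > 0"
        have "u (\<lambda>\<omega>. c * X \<omega>) / c \<le> u X"
        proof (rule uge[OF X])
          fix q assume q: "q \<in> C"
          show "u (\<lambda>\<omega>. c * X \<omega>) / c \<le> q X"
            using ule[OF scale_mem[OF X] q, of c] sublinear_functional_scale[OF sub[OF q] X, of c] c
            by (simp add: field_simps)
        qed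
        then show "u (\<lambda>\<omega>. c * X \<omega>) \<le> c * u X"
          using c by (simp add: field_simps)
      qed
      moreover have "u X \<le> p X" if "X \<in> H" for X
        using False ule[OF that] le[OF _ that] by (meson ex_in_conv order_trans)
      ultimately have "u \<in> A"
        by (auto simp: A_def u_def cut_def)
      moreover have "R q u" if "q \<in> C" for q
        using ule[OF _ that] out[OF that] by (auto simp: R_def le_fun_def u_def cut_def)
      ultimately show ?thesis by blast
    qed
  qed
  then obtain q where q: "q \<in> A" and min: "\<And>r. r \<in> A \<Longrightarrow> r \<le> q \<Longrightarrow> r = q"
    by (auto simp: R_def)
  show thesis
  proof (rule that)
    show "sublinear_functional q" "\<And>X. X \<in> H \<Longrightarrow> q X \<le> p X"
      using q by (auto simp: A_def)
    fix r X assume r: "sublinear_functional r" "\<And>X. X \<in> H \<Longrightarrow> r X \<le> q X" and X: "X \<in> H"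
    have "cut r \<in> A"
      using r q cut order_trans by (fastforce simp: A_def cut_def)
    moreover have "cut r \<le> q"
      using r q by (auto simp: A_def cut_def le_fun_def)
    ultimately have "cut r = q" by (rule min)
    then show "r X = q X" using X by (auto simp: cut_def)
  qed
qed

text \<open>A minimal sublinear functional is linear. The ray of constraints generated by
  \<open>- Y\<close> with bound \<open>- q Y\<close> is consistent with \<open>q\<close>, so it
  produces a sublinear functional below \<open>q\<close>, which by minimality equals
  \<open>q\<close>. Hence \<open>q\<close> is odd, and subadditivity applied to negatives gives
  superadditivity.\<close>

lemma dominated_linear_functional:
  assumes p: "sublinear_functional p"
  obtains q where "\<And>X. X \<in> H \<Longrightarrow> q X \<le> p X"
    "\<And>X Y a b. X \<in> H \<Longrightarrow> Y \<in> H \<Longrightarrow> q (\<lambda>\<omega>. a * X \<omega> + b * Y \<omega>) = a * q X + b * q Y"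
proof -
  obtain q where q: "sublinear_functional q" and le: "\<And>X. X \<in> H \<Longrightarrow> q X \<le> p X"
    and min: "\<And>r X. sublinear_functional r \<Longrightarrow> (\<And>X. X \<in> H \<Longrightarrow> r X \<le> q X) \<Longrightarrow> X \<in> H \<Longrightarrow> r X = q X"
    using minimal_sublinear_functional[OF p] by blast
  have neg: "q (\<lambda>\<omega>. - Y \<omega>) = - q Y" if Y: "Y \<in> H" for Y
  proof -
    define C where "C = {((\<lambda>\<omega>. - t * Y \<omega>), - t * q Y) | t. t \<ge> 0}"
    obtain r where r: "sublinear_functional r" "\<And>X. X \<in> H \<Longrightarrow> r X \<le> q X"
      "\<And>Z b. (Z, b) \<in> C \<Longrightarrow> r Z \<le> b"
    proof (rule sublinear_functional_restrict[OF q, of C])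
      show "Z \<in> H" if Z: "(Z, b) \<in> C" for Z b
        proof -
        obtain t where "Z = (\<lambda>\<omega>. - t * Y \<omega>)"
          using Z by (auto simp: C_def)
        then show ?thesis using scale_mem[OF Y, of "- t"] by simp
      qed
      show "((\<lambda>_. 0), 0) \<in> C"
        unfolding C_def by (auto intro!: exI[of _ 0])
      show "((\<lambda>\<omega>. Z \<omega> + Z' \<omega>), b + b') \<in> C" if Z: "(Z, b) \<in> C" "(Z', b') \<in> C" for Z b Z' b'
      proof -
        obtain t t' where t: "t \<ge> 0" "t' \<ge> 0" "Z = (\<lambda>\<omega>. - t * Y \<omega>)" "b = - t * q Y"
          "Z' = (\<lambda>\<omega>. - t' * Y \<omega>)" "b' = - t' * q Y"
          using Z by (auto simp: C_def)
        then show ?thesis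
          unfolding C_def by (auto intro!: exI[of _ "t + t'"] simp: algebra_simps)
      qed
      show "((\<lambda>\<omega>. c * Z \<omega>), c * b) \<in> C" if Z: "(Z, b) \<in> C" and "c > 0" for Z b c
      proof -
        obtain t where t: "t \<ge> 0" "Z = (\<lambda>\<omega>. - t * Y \<omega>)" "b = - t * q Y"
          using Z by (auto simp: C_def)
        then show ?thesis
          unfolding C_def using \<open>c > 0\<close> by (auto intro!: exI[of _ "c * t"] simp: algebra_simps)
      qed
      show "- q (\<lambda>\<omega>. - Z \<omega>) \<le> b" if "(Z, b) \<in> C" for Z b
        using that sublinear_functional_scale[OF q Y] by (auto simp: C_def)
    qed blast
    have "((\<lambda>\<omega>. - Y \<omega>), - q Y) \<in> C"
      unfolding C_def by (auto intro!: exI[of _ 1])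
    then have "r (\<lambda>\<omega>. - Y \<omega>) \<le> - q Y" by (rule r(3))
    moreover have "r (\<lambda>\<omega>. - Y \<omega>) = q (\<lambda>\<omega>. - Y \<omega>)"
      using min[OF r(1,2)] uminus_mem[OF Y] by blast
    ultimately show ?thesis
      using sublinear_functional_uminus[OF q Y] by simp
  qed
  have add: "q (\<lambda>\<omega>. X \<omega> + Y \<omega>) = q X + q Y" if X: "X \<in> H" and Y: "Y \<in> H" for X Y
  proof (rule antisym)
    have "q (\<lambda>\<omega>. - X \<omega> + - Y \<omega>) \<le> q (\<lambda>\<omega>. - X \<omega>) + q (\<lambda>\<omega>. - Y \<omega>)"
      by (rule sublinear_functional_add[OF q uminus_mem[OF X] uminus_mem[OF Y]])
    moreover have "(\<lambda>\<omega>. - X \<omega> + - Y \<omega>) = (\<lambda>\<omega>. - (X \<omega> + Y \<omega>))" by auto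
    ultimately show "q X + q Y \<le> q (\<lambda>\<omega>. X \<omega> + Y \<omega>)"
      using neg[OF X] neg[OF Y] neg[OF add_mem[OF X Y]] by simp
  qed (rule sublinear_functional_add[OF q X Y])
  have scale: "q (\<lambda>\<omega>. c * X \<omega>) = c * q X" if X: "X \<in> H" for X c
  proof (cases "c \<ge> 0")
    case False
    then have "q (\<lambda>\<omega>. - c * X \<omega>) = - c * q X"
      by (intro sublinear_functional_scale[OF q X]) simp
    moreover have "q (\<lambda>\<omega>. - (c * X \<omega>)) = - q (\<lambda>\<omega>. c * X \<omega>)"
      by (rule neg[OF scale_mem[OF X]])
    ultimately show ?thesis by simp
  qed (rule sublinear_functional_scale[OF q X])
  show thesis
    by (rule that[OF le]) (auto simp: add scale scale_mem)
qed

end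

subsection \<open>The sum norm and Lipschitz functions\<close>

lemma norm1_nonneg: "0 \<le> norm1 x"
  by (simp add: norm1_def sum_nonneg)

lemma norm1_zero [simp]: "norm1 0 = 0"
  by (simp add: norm1_def)

lemma norm1_triangle: "norm1 (x + y) \<le> norm1 x + norm1 y"
  by (auto simp: norm1_def simp flip: sum.distrib intro!: sum_mono)

lemma norm1_minus [simp]: "norm1 (- x) = norm1 x"
  by (simp add: norm1_def)

lemma norm1_diff_commute: "norm1 (x - y) = norm1 (y - x)"
  by (metis minus_diff_eq norm1_minus)

lemma norm1_scaleR [simp]: "norm1 (c *\<^sub>R x) = \<bar>c\<bar> * norm1 x"
  by (simp add: norm1_def abs_mult sum_distrib_left)

lemma norm1_sum: "norm1 (\<Sum>i\<in>I. f i) \<le> (\<Sum>i\<in>I. norm1 (f i))"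
  by (induction I rule: infinite_finite_induct) (auto intro: order_trans[OF norm1_triangle])

lemma norm_le_norm1: "norm x \<le> norm1 x"
  unfolding norm1_def by (rule norm_le_l1_cart)

lemma norm1_le_norm: "norm1 (x :: real ^ 'd) \<le> CARD('d) * norm x"
proof -
  have "norm1 x \<le> (\<Sum>i\<in>(UNIV::'d set). norm x)"
    unfolding norm1_def by (intro sum_mono component_le_norm_cart)
  then show ?thesis by simp
qed

lemma lipschitz_dist_RdD:
  "lipschitz_wrt dist_Rd l f \<Longrightarrow> \<bar>f x - f y\<bar> \<le> l * norm1 (x - y)"
  by (simp add: lipschitz_wrt_def dist_Rd_def)

lemma lipschitz_dist_RdI:
  "(\<And>x y. f x - f y \<le> l * norm1 (x - y)) \<Longrightarrow> lipschitz_wrt dist_Rd l f"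
  unfolding lipschitz_wrt_def dist_Rd_def abs_le_iff minus_diff_eq
  using norm1_diff_commute by metis

lemma lipschitz_dist_Rd_normI:
  assumes "\<And>x y. f x - f y \<le> l * norm (x - y)" and "l \<ge> 0"
  shows "lipschitz_wrt dist_Rd l f"
proof (rule lipschitz_dist_RdI)
  fix x y :: "real ^ 'a"
  have "l * norm (x - y) \<le> l * norm1 (x - y)"
    using assms(2) by (intro mult_left_mono norm_le_norm1)
  with assms(1)[of x y] show "f x - f y \<le> l * norm1 (x - y)" by simp
qed

lemma lipschitz_norm1: "lipschitz_wrt dist_Rd 1 (\<lambda>x. norm1 (x - y))"
proof (rule lipschitz_dist_RdI)
  fix x z :: "real ^ 'a"
  show "norm1 (x - y) - norm1 (z - y) \<le> 1 * norm1 (x - z)"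
    using norm1_triangle[of "x - z" "z - y"] by simp
qed

lemma lipschitz_inner: "lipschitz_wrt dist_Rd (norm v) (\<lambda>x. v \<bullet> x)"
  by (rule lipschitz_dist_Rd_normI)
    (simp_all add: norm_cauchy_schwarz flip: inner_diff_right)

lemma lipschitz_affine:
  assumes "lipschitz_wrt dist_Rd l f"
  shows "lipschitz_wrt dist_Rd (l * \<bar>c\<bar>) (\<lambda>x. f (c *\<^sub>R x + y))"
  unfolding lipschitz_wrt_def dist_Rd_def
proof (intro allI)
  fix x z
  show "\<bar>f (c *\<^sub>R x + y) - f (c *\<^sub>R z + y)\<bar> \<le> l * \<bar>c\<bar> * norm1 (x - z)"
    using lipschitz_dist_RdD[OF assms, of "c *\<^sub>R x + y" "c *\<^sub>R z + y"]
    by (simp add: mult.assoc flip: scaleR_diff_right)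
qed

subsection \<open>Random vectors\<close>

context random_variable_space
begin

text \<open>The closure axiom of \<open>H\<close> speaks of sequences, so the coordinates are
  enumerated by a bijection \<open>e\<close> with inverse \<open>f\<close>. Under this enumeration
  \<open>norm1\<close> becomes \<open>dist_Rn\<close> exactly, and the Lipschitz constant is
  kept.\<close>

lemma random_vector_lipschitz_mem:
  fixes Y :: "'w \<Rightarrow> real ^ 'd"
  assumes Y: "Y \<in> random_vectors H" and \<psi>: "lipschitz_wrt dist_Rd l \<psi>"
  shows "(\<lambda>\<omega>. \<psi> (Y \<omega>)) \<in> H"
proof -
  obtain e :: "nat \<Rightarrow> 'd" where e: "bij_betw e {0..<CARD('d)} UNIV"
    using ex_bij_betw_nat_finite[of "UNIV :: 'd set"] by auto
  define f where "f = inv_into {0..<CARD('d)} e"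
  have ef: "e (f j) = j" for j
    using e by (simp add: f_def bij_betw_inv_into_right)
  have f: "bij_betw f UNIV {0..<CARD('d)}"
    unfolding f_def by (rule bij_betw_inv_into[OF e])
  have "lipschitz_wrt (dist_Rn CARD('d)) l (\<lambda>x. \<psi> (\<chi> j. x (f j)))"
    unfolding lipschitz_wrt_def
  proof (intro allI)
    fix x y :: "nat \<Rightarrow> real"
    have "norm1 ((\<chi> j. x (f j)) - (\<chi> j. y (f j))) = (\<Sum>j\<in>UNIV. \<bar>x (f j) - y (f j)\<bar>)"
      by (simp add: norm1_def)
    also have "\<dots> = dist_Rn CARD('d) x y"
      using sum.reindex_bij_betw[OF f, of "\<lambda>i. \<bar>x i - y i\<bar>"]
      by (simp add: dist_Rn_def atLeast0LessThan)
    finally show "\<bar>\<psi> (\<chi> j. x (f j)) - \<psi> (\<chi> j. y (f j))\<bar> \<le> l * dist_Rn CARD('d) x y"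
      using lipschitz_dist_RdD[OF \<psi>, of "\<chi> j. x (f j)" "\<chi> j. y (f j)"] by simp
  qed
  then have "(\<lambda>\<omega>. \<psi> (\<chi> j. Y \<omega> $ e (f j))) \<in> H"
    using Y lipschitz_mem[of "CARD('d)" "\<lambda>i \<omega>. Y \<omega> $ e i"] by (simp add: random_vectors_def)
  then show ?thesis by (simp add: ef)
qed

lemma random_vector_scaleR_mem:
  "Y \<in> random_vectors H \<Longrightarrow> (\<lambda>\<omega>. c *\<^sub>R Y \<omega>) \<in> random_vectors H"
  by (simp add: random_vectors_def scale_mem)

lemma random_vector_sum_mem:
  "(\<And>i. i \<in> I \<Longrightarrow> Y i \<in> random_vectors H) \<Longrightarrow> (\<lambda>\<omega>. \<Sum>i\<in>I. Y i \<omega>) \<in> random_vectors H"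
  by (simp add: random_vectors_def sum_mem)

lemma random_vector_diff_mem:
  "Y \<in> random_vectors H \<Longrightarrow> Z \<in> random_vectors H \<Longrightarrow> (\<lambda>\<omega>. Y \<omega> - Z \<omega>) \<in> random_vectors H"
  by (simp add: random_vectors_def diff_mem)

lemma random_vector_inner_mem: "Y \<in> random_vectors H \<Longrightarrow> (\<lambda>\<omega>. v \<bullet> Y \<omega>) \<in> H"
  using random_vector_lipschitz_mem[OF _ lipschitz_inner[of v], of Y] .

lemma random_vector_norm1_mem: "Y \<in> random_vectors H \<Longrightarrow> (\<lambda>\<omega>. norm1 (Y \<omega>)) \<in> H"
  using random_vector_lipschitz_mem[OF _ lipschitz_norm1[of 0], of Y] by simp

lemma block_mean_mem:
  "(\<And>u. u \<in> \<Lambda> \<Longrightarrow> X u \<in> random_vectors H) \<Longrightarrow> block_mean X \<Lambda> \<in> random_vectors H"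
  unfolding block_mean_def [abs_def]
  by (intro random_vector_scaleR_mem random_vector_sum_mem)

end

section \<open>Calculus of sublinear expectations and Hahn-Banach with constraints\<close>

context sublinear_expectation
begin

lemma sublinear_functional_expectation: "sublinear_functional E"
  unfolding sublinear_functional_def using subadditive pos_homogeneous by blast

lemma expectation_sum_le:
  assumes "\<And>i. i \<in> I \<Longrightarrow> Z i \<in> H"
  shows "E (\<lambda>\<omega>. \<Sum>i\<in>I. Z i \<omega>) \<le> (\<Sum>i\<in>I. E (Z i))"
  using assms
proof (induction I rule: infinite_finite_induct)
  case (insert i I)
  then have "E (\<lambda>\<omega>. Z i \<omega> + (\<Sum>i\<in>I. Z i \<omega>)) \<le> E (Z i) + E (\<lambda>\<omega>. \<Sum>i\<in>I. Z i \<omega>)"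
    by (intro subadditive sum_mem) auto
  also have "\<dots> \<le> E (Z i) + (\<Sum>i\<in>I. E (Z i))"
    using insert by simp
  finally show ?case using insert by simp
qed (auto simp: const)

text \<open>Subadditivity is used twice, once adding \<open>c\<close> and once adding
  \<open>- c\<close>.\<close>

lemma expectation_add_const:
  assumes "X \<in> H"
  shows "E (\<lambda>\<omega>. X \<omega> + c) = E X + c"
proof (rule antisym)
  show "E (\<lambda>\<omega>. X \<omega> + c) \<le> E X + c"
    using subadditive[OF assms const_mem, of c] by (simp add: const)
  have "E (\<lambda>\<omega>. (X \<omega> + c) + - c) \<le> E (\<lambda>\<omega>. X \<omega> + c) + E (\<lambda>_. - c)"
    by (intro subadditive add_mem assms const_mem)
  then show "E X + c \<le> E (\<lambda>\<omega>. X \<omega> + c)"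
    by (simp add: const)
qed

lemma expectation_diff_le:
  assumes "X \<in> H" "Y \<in> H"
  shows "E X - E Y \<le> E (\<lambda>\<omega>. X \<omega> - Y \<omega>)"
  using subadditive[OF diff_mem[OF assms] assms(2)] by simp

lemma expectation_abs_diff_le:
  assumes X: "X \<in> H" and Y: "Y \<in> H" and Z: "Z \<in> H" and le: "\<And>\<omega>. \<bar>X \<omega> - Y \<omega>\<bar> \<le> Z \<omega>"
  shows "\<bar>E X - E Y\<bar> \<le> E Z"
proof -
  have "X \<omega> - Y \<omega> \<le> Z \<omega>" "Y \<omega> - X \<omega> \<le> Z \<omega>" for \<omega>
    using le[of \<omega>] by auto
  then have "E (\<lambda>\<omega>. X \<omega> - Y \<omega>) \<le> E Z" "E (\<lambda>\<omega>. Y \<omega> - X \<omega>) \<le> E Z"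
    using X Y Z by (auto intro!: mono diff_mem)
  with expectation_diff_le[OF X Y] expectation_diff_le[OF Y X] show ?thesis
    by auto
qed

text \<open>The form of Hahn-Banach used below: a cone of constraints, each consistent with the
  lower expectation \<open>- E (- Y)\<close>, is first absorbed into a smaller sublinear functional,
  below which a linear one is then chosen. Domination by \<open>E\<close> makes it an expectation:
  \<open>X - Y \<le> 0\<close> gives \<open>F (X - Y) \<le> 0\<close>, and the bounds at
  \<open>c\<close> and \<open>- c\<close> fix the constants.\<close>

lemma dominated_linear_expectation_constrained:
  fixes C :: "(('w \<Rightarrow> real) \<times> real) set"
  assumes mem: "\<And>Y b. (Y, b) \<in> C \<Longrightarrow> Y \<in> H"
    and zero: "((\<lambda>_. 0), 0) \<in> C"
    and add: "\<And>Y b Y' b'. (Y, b) \<in> C \<Longrightarrow> (Y', b') \<in> C \<Longrightarrow> ((\<lambda>\<omega>. Y \<omega> + Y' \<omega>), b + b') \<in> C"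
    and scale: "\<And>Y b c. (Y, b) \<in> C \<Longrightarrow> c > 0 \<Longrightarrow> ((\<lambda>\<omega>. c * Y \<omega>), c * b) \<in> C"
    and bound: "\<And>Y b. (Y, b) \<in> C \<Longrightarrow> - E (\<lambda>\<omega>. - Y \<omega>) \<le> b"
  obtains F where "F \<in> dominated_linear_expectations H E" "\<And>Y b. (Y, b) \<in> C \<Longrightarrow> F Y \<le> b"
proof -
  obtain q where q: "sublinear_functional q" "\<And>X. X \<in> H \<Longrightarrow> q X \<le> E X"
    "\<And>Y b. (Y, b) \<in> C \<Longrightarrow> q Y \<le> b"
    by (rule sublinear_functional_restrict[OF sublinear_functional_expectation mem zero add scale bound])
      blast+
  obtain F where Fq: "\<And>X. X \<in> H \<Longrightarrow> F X \<le> q X"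
    and linear: "\<And>X Y a b. X \<in> H \<Longrightarrow> Y \<in> H \<Longrightarrow> F (\<lambda>\<omega>. a * X \<omega> + b * Y \<omega>) = a * F X + b * F Y"
    using dominated_linear_functional[OF q(1)] by blast
  have FE: "F X \<le> E X" if "X \<in> H" for X
    using Fq[OF that] q(2)[OF that] by simp
  have scaleF: "F (\<lambda>\<omega>. c * X \<omega>) = c * F X" if "X \<in> H" for X c
    using linear[OF that that, of c 0] by simp
  have addF: "F (\<lambda>\<omega>. X \<omega> + Y \<omega>) = F X + F Y" if "X \<in> H" "Y \<in> H" for X Y
    using linear[OF that, of 1 1] by simp
  have "linear_expectation H F"
  proof unfold_locales
    fix X Y assume X: "X \<in> H" and Y: "Y \<in> H" and le: "\<forall>\<omega>. X \<omega> \<le> Y \<omega>"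
    have "F (\<lambda>\<omega>. 1 * X \<omega> + - 1 * Y \<omega>) \<le> E (\<lambda>\<omega>. X \<omega> - Y \<omega>)"
      using FE[OF diff_mem[OF X Y]] by simp
    also have "\<dots> \<le> E (\<lambda>_. 0)"
      using le by (intro mono diff_mem X Y zero_mem) auto
    finally show "F X \<le> F Y"
      using linear[OF X Y, of 1 "-1"] by (simp add: const)
  next
    fix c
    have "F (\<lambda>_. c) \<le> c"
      using FE[OF const_mem, of c] by (simp add: const)
    moreover have "- F (\<lambda>_. c) \<le> - c"
      using FE[OF const_mem, of "- c"] scaleF[OF const_mem, of "-1" c] by (simp add: const)
    ultimately show "F (\<lambda>_. c) = c" by simp
  qed (auto simp: addF scaleF linear)
  with FE have "F \<in> dominated_linear_expectations H E"
    by (simp add: dominated_linear_expectations_def)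
  moreover have "F Y \<le> b" if "(Y, b) \<in> C" for Y b
    using Fq[OF mem[OF that]] q(3)[OF that] by simp
  ultimately show thesis
    by (rule that)
qed

end

lemma (in linear_expectation) expectation_sum:
  assumes "\<And>i. i \<in> I \<Longrightarrow> Z i \<in> H"
  shows "E (\<lambda>\<omega>. \<Sum>i\<in>I. c i * Z i \<omega>) = (\<Sum>i\<in>I. c i * E (Z i))"
  using assms
proof (induction I rule: infinite_finite_induct)
  case (insert i I)
  have "E (\<lambda>\<omega>. c i * Z i \<omega> + 1 * (\<Sum>i\<in>I. c i * Z i \<omega>)) = c i * E (Z i) + 1 * E (\<lambda>\<omega>. \<Sum>i\<in>I. c i * Z i \<omega>)"
    using insert by (intro linear sum_mem scale_mem) auto
  then show ?case using insert by simp
qed (auto simp: const)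

lemma (in linear_expectation) inner_vec_expectation:
  assumes "Y \<in> random_vectors H"
  shows "E (\<lambda>\<omega>. v \<bullet> Y \<omega>) = v \<bullet> vec_expectation E Y"
  using expectation_sum[of UNIV "\<lambda>i \<omega>. Y \<omega> $ i" "\<lambda>i. v $ i"] assms
  by (simp add: inner_vec_def vec_expectation_def random_vectors_def)

section \<open>Mean vectors under dominated linear expectations, as compact convex sets\<close>

context sublinear_expectation
begin

text \<open>For \<open>Y = M n\<close> this is the mean set of the theorem, by
  \<open>mean_set_eq\<close>.\<close>

definition mean_values :: "('w \<Rightarrow> real ^ 'd) \<Rightarrow> (real ^ 'd) set"
  where "mean_values Y = {vec_expectation F Y | F. F \<in> dominated_linear_expectations H E}"

text \<open>The set is the intersection of its supporting half-spaces. For the converse direction,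
  the constraints \<open>F (v \<bullet> Y) \<le> v \<bullet> x\<close> over all \<open>v\<close>
  form a cone, consistent with \<open>E\<close> by the hypothesis at \<open>- v\<close>. Using them
  at both \<open>v\<close> and \<open>- v\<close> turns them into equalities, so \<open>F\<close>
  has mean vector \<open>x\<close>.\<close>

lemma mean_values_iff:
  fixes Y :: "'w \<Rightarrow> real ^ 'd"
  assumes Y: "Y \<in> random_vectors H"
  shows "x \<in> mean_values Y \<longleftrightarrow> (\<forall>v. v \<bullet> x \<le> E (\<lambda>\<omega>. v \<bullet> Y \<omega>))"
proof
  assume "x \<in> mean_values Y"
  then obtain F where F: "linear_expectation H F" "\<And>X. X \<in> H \<Longrightarrow> F X \<le> E X"
    and x: "x = vec_expectation F Y"
    by (auto simp: mean_values_def dominated_linear_expectations_def)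
  show "\<forall>v. v \<bullet> x \<le> E (\<lambda>\<omega>. v \<bullet> Y \<omega>)"
    using F(2)[OF random_vector_inner_mem[OF Y]]
    by (simp add: x linear_expectation.inner_vec_expectation[OF F(1) Y])
next
  assume x: "\<forall>v. v \<bullet> x \<le> E (\<lambda>\<omega>. v \<bullet> Y \<omega>)"
  define C where "C = {((\<lambda>\<omega>. v \<bullet> Y \<omega>), v \<bullet> x) | v. True}"
  have C: "((\<lambda>\<omega>. v \<bullet> Y \<omega>), v \<bullet> x) \<in> C" for v
    by (auto simp: C_def)
  have Cw: "(f, b) \<in> C" if "f = (\<lambda>\<omega>. v \<bullet> Y \<omega>)" "b = v \<bullet> x" for f b v
    using that C by simp
  obtain F where F: "F \<in> dominated_linear_expectations H E" "\<And>Z b. (Z, b) \<in> C \<Longrightarrow> F Z \<le> b"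
  proof (rule dominated_linear_expectation_constrained[of C])
    fix Z b assume "(Z, b) \<in> C"
    then obtain v where Z: "Z = (\<lambda>\<omega>. v \<bullet> Y \<omega>)" "b = v \<bullet> x" by (auto simp: C_def)
    show "Z \<in> H" using random_vector_inner_mem[OF Y] Z by simp
    show "- E (\<lambda>\<omega>. - Z \<omega>) \<le> b"
      using x[rule_format, of "- v"] Z by simp
    show "((\<lambda>\<omega>. c * Z \<omega>), c * b) \<in> C" for c
      by (rule Cw[of _ "c *\<^sub>R v"]) (auto simp: Z)
    fix Z' b' assume "(Z', b') \<in> C"
    then obtain v' where Z': "Z' = (\<lambda>\<omega>. v' \<bullet> Y \<omega>)" "b' = v' \<bullet> x" by (auto simp: C_def)
    show "((\<lambda>\<omega>. Z \<omega> + Z' \<omega>), b + b') \<in> C"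
      by (rule Cw[of _ "v + v'"]) (auto simp: Z Z' inner_add_left)
  next
    show "((\<lambda>_. 0), 0) \<in> C"
      by (rule Cw[of _ 0]) auto
  qed blast
  then have lin: "linear_expectation H F"
    by (simp add: dominated_linear_expectations_def)
  have le: "v \<bullet> vec_expectation F Y \<le> v \<bullet> x" for v
    using F(2)[OF C] by (simp add: linear_expectation.inner_vec_expectation[OF lin Y])
  have "v \<bullet> vec_expectation F Y = v \<bullet> x" for v
    using le[of v] le[of "- v"] by simp
  then have "vec_expectation F Y = x"
    using vector_eq_ldot by blast
  with F(1) show "x \<in> mean_values Y"
    by (auto simp: mean_values_def)
qed

text \<open>The ray of constraints generated by \<open>F (- Z) \<le> - E Z\<close> forces
  \<open>F Z = E Z\<close>. Together with \<open>mean_values_iff\<close> this makes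
  \<open>E (v \<bullet> Y)\<close> the support function of the set.\<close>

lemma mean_values_attain:
  assumes Y: "Y \<in> random_vectors H"
  obtains x where "x \<in> mean_values Y" "v \<bullet> x = E (\<lambda>\<omega>. v \<bullet> Y \<omega>)"
proof -
  define Z where "Z = (\<lambda>\<omega>. v \<bullet> Y \<omega>)"
  have Z: "Z \<in> H"
    using random_vector_inner_mem[OF Y] by (simp add: Z_def)
  define C where "C = {((\<lambda>\<omega>. - t * Z \<omega>), - t * E Z) | t. t \<ge> 0}"
  have C: "(f, b) \<in> C" if "f = (\<lambda>\<omega>. - t * Z \<omega>)" "b = - t * E Z" "t \<ge> 0" for f b t
    using that by (auto simp: C_def)
  obtain F where F: "F \<in> dominated_linear_expectations H E" "\<And>V b. (V, b) \<in> C \<Longrightarrow> F V \<le> b"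
  proof (rule dominated_linear_expectation_constrained[of C])
    fix V b assume "(V, b) \<in> C"
    then obtain t where V: "t \<ge> 0" "V = (\<lambda>\<omega>. - t * Z \<omega>)" "b = - t * E Z" by (auto simp: C_def)
    show "V \<in> H" using scale_mem[OF Z, of "- t"] V by simp
    show "- E (\<lambda>\<omega>. - V \<omega>) \<le> b"
      using pos_homogeneous[OF Z V(1)] V by simp
    show "((\<lambda>\<omega>. c * V \<omega>), c * b) \<in> C" if "c > 0" for c
      by (rule C[of _ "c * t"]) (use that in \<open>auto simp: V\<close>)
    fix V' b' assume "(V', b') \<in> C"
    then obtain t' where V': "t' \<ge> 0" "V' = (\<lambda>\<omega>. - t' * Z \<omega>)" "b' = - t' * E Z"
      by (auto simp: C_def)
    show "((\<lambda>\<omega>. V \<omega> + V' \<omega>), b + b') \<in> C"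
      by (rule C[of _ "t + t'"]) (use V V' in \<open>auto simp: algebra_simps\<close>)
  next
    show "((\<lambda>_. 0), 0) \<in> C"
      by (rule C[of _ 0]) auto
  qed blast
  then have lin: "linear_expectation H F" and le: "\<And>X. X \<in> H \<Longrightarrow> F X \<le> E X"
    by (auto simp: dominated_linear_expectations_def)
  have "F (\<lambda>\<omega>. - Z \<omega>) \<le> - E Z"
    by (rule F(2), rule C[of _ 1]) auto
  moreover have "F (\<lambda>\<omega>. - Z \<omega>) = - F Z"
    using linear_expectation.linear[OF lin Z Z, of "-1" 0] by simp
  ultimately have "F Z = E Z"
    using le[OF Z] by simp
  then have "v \<bullet> vec_expectation F Y = E (\<lambda>\<omega>. v \<bullet> Y \<omega>)"
    using linear_expectation.inner_vec_expectation[OF lin Y, of v] by (simp add: Z_def)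
  with F(1) show thesis
    by (intro that[of "vec_expectation F Y"]) (auto simp: mean_values_def)
qed

lemma convex_mean_values:
  assumes Y: "Y \<in> random_vectors H"
  shows "convex (mean_values Y)"
proof -
  have "mean_values Y = (\<Inter>v. {x. v \<bullet> x \<le> E (\<lambda>\<omega>. v \<bullet> Y \<omega>)})"
    using mean_values_iff[OF Y] by auto
  then show ?thesis by (auto intro!: convex_INT convex_halfspace_le)
qed

lemma compact_mean_values:
  fixes Y :: "'w \<Rightarrow> real ^ 'd"
  assumes Y: "Y \<in> random_vectors H"
  shows "compact (mean_values Y)"
proof -
  have eq: "mean_values Y = (\<Inter>v. {x. v \<bullet> x \<le> E (\<lambda>\<omega>. v \<bullet> Y \<omega>)})"
    using mean_values_iff[OF Y] by auto
  have "closed (mean_values Y)"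
    unfolding eq by (auto intro!: closed_INT closed_halfspace_le)
  \<comment> \<open>Boundedness comes from testing \<open>x\<close> in its own direction: \<open>x
    \<bullet> x \<le> E (x \<bullet> Y) \<le> norm x * E (norm1 Y)\<close>.\<close>
  moreover have "norm x \<le> E (\<lambda>\<omega>. norm1 (Y \<omega>))" if x: "x \<in> mean_values Y" for x
  proof (cases "x = 0")
    case True
    have "E (\<lambda>_. 0) \<le> E (\<lambda>\<omega>. norm1 (Y \<omega>))"
      by (intro mono zero_mem random_vector_norm1_mem Y) (simp add: norm1_nonneg)
    with True show ?thesis by (simp add: const)
  next
    case False
    have "norm x * norm x = x \<bullet> x"
      by (simp flip: power2_norm_eq_inner power2_eq_square)
    also have "\<dots> \<le> E (\<lambda>\<omega>. x \<bullet> Y \<omega>)"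
      using x mean_values_iff[OF Y] by blast
    also have "\<dots> \<le> E (\<lambda>\<omega>. norm x * norm1 (Y \<omega>))"
    proof (intro mono random_vector_inner_mem scale_mem random_vector_norm1_mem Y allI)
      show "x \<bullet> Y \<omega> \<le> norm x * norm1 (Y \<omega>)" for \<omega>
        using norm_cauchy_schwarz[of x "Y \<omega>"] mult_left_mono[OF norm_le_norm1[of "Y \<omega>"] norm_ge_zero[of x]]
        by simp
    qed
    also have "\<dots> = norm x * E (\<lambda>\<omega>. norm1 (Y \<omega>))"
      by (intro pos_homogeneous random_vector_norm1_mem Y) simp
    finally show ?thesis using False by simp
  qed
  then have "bounded (mean_values Y)"
    by (auto simp: bounded_iff)
  ultimately show ?thesis
    by (simp add: compact_eq_bounded_closed)
qed

end

subsection \<open>Block means of a stationary mixing sequence\<close>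

text \<open>The mixing constant is fixed as the parameter \<open>c\<close>, so that all later
  constants are explicit expressions in the data and visibly uniform in the test function.\<close>

locale mixing_sequence = sublinear_expectation H E
  for H :: "('w \<Rightarrow> real) set" and E :: "('w \<Rightarrow> real) \<Rightarrow> real" +
  fixes X :: "nat \<Rightarrow> 'w \<Rightarrow> real ^ 'd" and \<alpha> c :: real
  assumes X_mem: "k \<ge> 1 \<Longrightarrow> X k \<in> random_vectors H"
    and stationary: "stationary E X"
    and \<alpha>_pos: "\<alpha> > 0"
    and c_pos: "c > 0"
    and mixing: "\<forall>\<Lambda>\<^sub>1 \<Lambda>\<^sub>2. finite \<Lambda>\<^sub>1 \<and> \<Lambda>\<^sub>1 \<noteq> {} \<and> \<Lambda>\<^sub>1 \<subseteq> {1..} \<and>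
        finite \<Lambda>\<^sub>2 \<and> \<Lambda>\<^sub>2 \<noteq> {} \<and> \<Lambda>\<^sub>2 \<subseteq> {1..} \<and> Max \<Lambda>\<^sub>1 \<le> Min \<Lambda>\<^sub>2 \<longrightarrow>
      (\<forall>\<phi> l. l > 0 \<and> lipschitz_wrt dist_R2d l \<phi> \<longrightarrow>
        \<bar>E (\<lambda>\<omega>. \<phi> (block_mean X \<Lambda>\<^sub>1 \<omega>, block_mean X \<Lambda>\<^sub>2 \<omega>))
          - E (\<lambda>\<omega>. E (\<lambda>\<omega>'. \<phi> (block_mean X \<Lambda>\<^sub>1 \<omega>, block_mean X \<Lambda>\<^sub>2 \<omega>')))\<bar>
        \<le> c * l * exp (- \<alpha> * \<bar>real (Min \<Lambda>\<^sub>2) - real (Max \<Lambda>\<^sub>1)\<bar>))"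
    and square_mem: "(\<lambda>\<omega>. (norm1 (X 1 \<omega>))\<^sup>2) \<in> H"
begin

abbreviation M :: "nat \<Rightarrow> 'w \<Rightarrow> real ^ 'd"
  where "M n \<equiv> block_mean X {1..n}"

definition g :: "nat \<Rightarrow> real ^ 'd \<Rightarrow> real"
  where "g n v = E (\<lambda>\<omega>. v \<bullet> M n \<omega>)"

definition A :: real
  where "A = E (\<lambda>\<omega>. norm1 (X 1 \<omega>))"

text \<open>The one-step operator of a sequence of independent copies of the block mean \<open>M m\<close>.\<close>

definition P :: "nat \<Rightarrow> (real ^ 'd \<Rightarrow> real) \<Rightarrow> real ^ 'd \<Rightarrow> real"
  where "P m G z = E (\<lambda>\<omega>. G (z + M m \<omega>))"

text \<open>Here \<open>m\<close> is the length of a block and \<open>k\<close> the length of the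
  gap that follows it; the blocks are numbered from \<open>i = 0\<close>.\<close>

definition block :: "nat \<Rightarrow> nat \<Rightarrow> nat \<Rightarrow> nat set"
  where "block m k i = {i * (m + k) + 1..i * (m + k) + m}"

definition blocks :: "nat \<Rightarrow> nat \<Rightarrow> nat \<Rightarrow> nat set"
  where "blocks m k N = (\<Union>i<N. block m k i)"

lemma block_mean_X_mem: "\<Lambda> \<subseteq> {1..} \<Longrightarrow> block_mean X \<Lambda> \<in> random_vectors H"
  by (intro block_mean_mem X_mem) auto

lemma M_mem: "M n \<in> random_vectors H"
  by (rule block_mean_X_mem) auto

lemma A_nonneg: "0 \<le> A"
proof -
  have "E (\<lambda>_. 0) \<le> A"
    unfolding A_def using X_mem[of 1]
    by (intro mono zero_mem random_vector_norm1_mem) (auto simp: norm1_nonneg)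
  then show ?thesis by (simp add: const)
qed

lemma block_mean_interval:
  "block_mean X {t + 1..t + m} \<omega> = (1 / real m) *\<^sub>R (\<Sum>i<m. X (t + (i + 1)) \<omega>)"
proof -
  have "(\<Sum>u=t+1..t+m. X u \<omega>) = (\<Sum>i<m. X (t + (i + 1)) \<omega>)"
    by (rule sum.reindex_bij_witness[of _ "\<lambda>i. t + (i + 1)" "\<lambda>u. u - (t + 1)"]) auto
  then show ?thesis by (simp add: block_mean_def)
qed

text \<open>The mean of \<open>m\<close> vectors is \<open>1 / m\<close>-Lipschitz for the sum
  distance, so \<open>\<psi>\<close> of a block mean is an admissible test function for stationarity
  at the times \<open>1, ..., m\<close>. For \<open>m = 0\<close> both means are zero, and for
  \<open>t = 0\<close> the two blocks coincide.\<close>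

lemma stationary_block_mean:
  assumes \<psi>: "lipschitz_wrt dist_Rd l \<psi>" and l: "l \<ge> 0"
  shows "E (\<lambda>\<omega>. \<psi> (block_mean X {t + 1..t + m} \<omega>)) = E (\<lambda>\<omega>. \<psi> (M m \<omega>))"
proof (cases "m = 0 \<or> t = 0")
  case False
  define \<theta> where "\<theta> = (\<lambda>x :: nat \<Rightarrow> real ^ 'd. \<psi> ((1 / real m) *\<^sub>R (\<Sum>i<m. x i)))"
  have "lipschitz_wrt (dist_Rdn m) (l / m) \<theta>"
    unfolding lipschitz_wrt_def
  proof (intro allI)
    fix x y :: "nat \<Rightarrow> real ^ 'd"
    have "\<bar>\<theta> x - \<theta> y\<bar> \<le> l * norm1 ((1 / real m) *\<^sub>R (\<Sum>i<m. x i - y i))"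
      unfolding \<theta>_def using lipschitz_dist_RdD[OF \<psi>]
      by (simp only: sum_subtractf scaleR_diff_right)
    also have "\<dots> = l / m * norm1 (\<Sum>i<m. x i - y i)"
      by simp
    also have "\<dots> \<le> l / m * dist_Rdn m x y"
      unfolding dist_Rdn_def using l by (intro mult_left_mono norm1_sum) auto
    finally show "\<bar>\<theta> x - \<theta> y\<bar> \<le> l / m * dist_Rdn m x y" .
  qed
  moreover have "identically_distributed E m (\<lambda>i. X (i + 1)) (\<lambda>i. X (t + (i + 1)))"
    using stationary[unfolded stationary_def, rule_format, of m t "\<lambda>i. i + 1"] False by auto
  ultimately have "E (\<lambda>\<omega>. \<theta> (\<lambda>i. X (i + 1) \<omega>)) = E (\<lambda>\<omega>. \<theta> (\<lambda>i. X (t + (i + 1)) \<omega>))"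
    by (auto simp: identically_distributed_def)
  moreover have "\<theta> (\<lambda>i. X (i + 1) \<omega>) = \<psi> (M m \<omega>)"
    "\<theta> (\<lambda>i. X (t + (i + 1)) \<omega>) = \<psi> (block_mean X {t + 1..t + m} \<omega>)" for \<omega>
    using block_mean_interval[of t] block_mean_interval[of 0] by (simp_all add: \<theta>_def)
  ultimately show ?thesis by simp
qed (auto simp: block_mean_def)

lemma stationary_single:
  assumes "lipschitz_wrt dist_Rd l \<psi>" "l \<ge> 0" "k \<ge> 1"
  shows "E (\<lambda>\<omega>. \<psi> (X k \<omega>)) = E (\<lambda>\<omega>. \<psi> (X 1 \<omega>))"
proof -
  have "{k - 1 + 1..k - 1 + 1} = {k}" using assms(3) by auto
  then show ?thesis
    using stationary_block_mean[OF assms(1,2), of "k - 1" 1] by (simp add: block_mean_def)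
qed

lemma expectation_norm1_X: "k \<ge> 1 \<Longrightarrow> E (\<lambda>\<omega>. norm1 (X k \<omega>)) = A"
  using stationary_single[OF lipschitz_norm1[of 0], of k] by (simp add: A_def)

lemma expectation_norm1_sum_le:
  assumes "\<Lambda> \<subseteq> {1..}"
  shows "E (\<lambda>\<omega>. norm1 (\<Sum>k\<in>\<Lambda>. a k *\<^sub>R X k \<omega>)) \<le> (\<Sum>k\<in>\<Lambda>. \<bar>a k\<bar>) * A"
proof -
  have mem: "X k \<in> random_vectors H" if "k \<in> \<Lambda>" for k
    using assms that by (intro X_mem) auto
  have "E (\<lambda>\<omega>. norm1 (\<Sum>k\<in>\<Lambda>. a k *\<^sub>R X k \<omega>)) \<le> E (\<lambda>\<omega>. \<Sum>k\<in>\<Lambda>. \<bar>a k\<bar> * norm1 (X k \<omega>))"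
  proof (intro mono random_vector_norm1_mem random_vector_sum_mem random_vector_scaleR_mem mem
        sum_mem scale_mem allI)
    show "norm1 (\<Sum>k\<in>\<Lambda>. a k *\<^sub>R X k \<omega>) \<le> (\<Sum>k\<in>\<Lambda>. \<bar>a k\<bar> * norm1 (X k \<omega>))" for \<omega>
      using norm1_sum[of "\<lambda>k. a k *\<^sub>R X k \<omega>"] by simp
  qed
  also have "\<dots> \<le> (\<Sum>k\<in>\<Lambda>. E (\<lambda>\<omega>. \<bar>a k\<bar> * norm1 (X k \<omega>)))"
    by (intro expectation_sum_le scale_mem random_vector_norm1_mem mem)
  also have "\<dots> = (\<Sum>k\<in>\<Lambda>. \<bar>a k\<bar> * A)"
  proof (rule sum.cong[OF refl])
    fix k assume k: "k \<in> \<Lambda>"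
    then have "k \<ge> 1" using assms by auto
    then show "E (\<lambda>\<omega>. \<bar>a k\<bar> * norm1 (X k \<omega>)) = \<bar>a k\<bar> * A"
      using pos_homogeneous[OF random_vector_norm1_mem[OF mem[OF k]], of "\<bar>a k\<bar>"]
      by (simp add: expectation_norm1_X)
  qed
  finally show ?thesis by (simp add: sum_distrib_right)
qed

lemma expectation_lipschitz_diff_le:
  assumes \<psi>: "lipschitz_wrt dist_Rd l \<psi>" and l: "l \<ge> 0"
    and Y: "Y \<in> random_vectors H" and Z: "Z \<in> random_vectors H"
  shows "\<bar>E (\<lambda>\<omega>. \<psi> (Y \<omega>)) - E (\<lambda>\<omega>. \<psi> (Z \<omega>))\<bar> \<le> l * E (\<lambda>\<omega>. norm1 (Y \<omega> - Z \<omega>))"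
proof -
  have N: "(\<lambda>\<omega>. norm1 (Y \<omega> - Z \<omega>)) \<in> H"
    by (intro random_vector_norm1_mem random_vector_diff_mem Y Z)
  have "\<bar>E (\<lambda>\<omega>. \<psi> (Y \<omega>)) - E (\<lambda>\<omega>. \<psi> (Z \<omega>))\<bar> \<le> E (\<lambda>\<omega>. l * norm1 (Y \<omega> - Z \<omega>))"
    by (rule expectation_abs_diff_le)
      (use random_vector_lipschitz_mem[OF Y \<psi>] random_vector_lipschitz_mem[OF Z \<psi>]
        scale_mem[OF N] lipschitz_dist_RdD[OF \<psi>] in auto)
  also have "\<dots> = l * E (\<lambda>\<omega>. norm1 (Y \<omega> - Z \<omega>))"
    by (rule pos_homogeneous[OF N l])
  finally show ?thesis .
qed

text \<open>The difference of the two means has weights \<open>1 / n\<close> off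
  \<open>\<Lambda>\<close> and \<open>1 / n - 1 / card \<Lambda>\<close> on
  \<open>\<Lambda>\<close>. Each group has total absolute weight
  \<open>(n - card \<Lambda>) / n\<close>, whence the factor 2. This prices the deletion of
  indices.\<close>

lemma block_mean_compare:
  assumes \<psi>: "lipschitz_wrt dist_Rd l \<psi>" and l: "l \<ge> 0"
    and \<Lambda>: "\<Lambda> \<subseteq> {1..n}" "\<Lambda> \<noteq> {}"
  shows "\<bar>E (\<lambda>\<omega>. \<psi> (M n \<omega>)) - E (\<lambda>\<omega>. \<psi> (block_mean X \<Lambda> \<omega>))\<bar>
    \<le> l * (2 * A * (real n - card \<Lambda>) / n)"
proof -
  have fin: "finite \<Lambda>" using \<Lambda> finite_subset by blast
  have n: "n > 0" using \<Lambda> by auto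
  have card: "card \<Lambda> > 0" "card \<Lambda> \<le> n"
    using fin \<Lambda> card_mono[of "{1..n}" \<Lambda>] by (auto simp: card_gt_0_iff)
  define a where "a = (\<lambda>k. 1 / real n - (if k \<in> \<Lambda> then 1 / real (card \<Lambda>) else 0))"
  have split: "(\<Sum>k=1..n. f k) = (\<Sum>k\<in>{1..n} - \<Lambda>. f k) + (\<Sum>k\<in>\<Lambda>. f k)" for f :: "nat \<Rightarrow> 'z :: comm_monoid_add"
    using \<Lambda> by (intro sum.subset_diff) auto
  have diff: "M n \<omega> - block_mean X \<Lambda> \<omega> = (\<Sum>k=1..n. a k *\<^sub>R X k \<omega>)" for \<omega>
  proof -
    have "(\<Sum>k=1..n. a k *\<^sub>R X k \<omega>) = (\<Sum>k\<in>{1..n} - \<Lambda>. (1 / real n) *\<^sub>R X k \<omega>)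
        + (\<Sum>k\<in>\<Lambda>. (1 / real n - 1 / real (card \<Lambda>)) *\<^sub>R X k \<omega>)"
      unfolding split by (simp add: a_def)
    then show ?thesis
      unfolding block_mean_def split
      by (simp add: scaleR_sum_right scaleR_add_right scaleR_diff_left sum_subtractf)
  qed
  have "(\<Sum>k=1..n. \<bar>a k\<bar>) = (\<Sum>k\<in>{1..n} - \<Lambda>. 1 / real n) + (\<Sum>k\<in>\<Lambda>. 1 / real (card \<Lambda>) - 1 / real n)"
    unfolding split using card n by (auto simp: a_def abs_if field_simps intro!: sum.cong)
  also have "\<dots> = 2 * (real n - card \<Lambda>) / n"
    using card n \<Lambda> fin by (simp add: card_Diff_subset of_nat_diff field_simps)
  finally have sum: "(\<Sum>k=1..n. \<bar>a k\<bar>) = 2 * (real n - card \<Lambda>) / n" .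
  have "\<bar>E (\<lambda>\<omega>. \<psi> (M n \<omega>)) - E (\<lambda>\<omega>. \<psi> (block_mean X \<Lambda> \<omega>))\<bar>
      \<le> l * E (\<lambda>\<omega>. norm1 (M n \<omega> - block_mean X \<Lambda> \<omega>))"
    using \<Lambda> by (intro expectation_lipschitz_diff_le \<psi> l M_mem block_mean_X_mem) auto
  also have "\<dots> \<le> l * ((\<Sum>k=1..n. \<bar>a k\<bar>) * A)"
    unfolding diff using l by (intro mult_left_mono expectation_norm1_sum_le) auto
  finally show ?thesis
    unfolding sum by (simp add: algebra_simps)
qed

section \<open>Arithmetic of blocks and gaps\<close>

lemma finite_block [simp]: "finite (block m k i)"
  by (simp add: block_def)

lemma card_block [simp]: "card (block m k i) = m"
  by (simp add: block_def)

lemma finite_blocks [simp]: "finite (blocks m k N)"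
  by (simp add: blocks_def)

lemma blocks_Suc: "blocks m k (Suc N) = blocks m k N \<union> block m k N"
  by (auto simp: blocks_def lessThan_Suc)

text \<open>The second bound retains the gap after the last block; it is what separates these blocks
  from the next one in \<open>decoupling\<close>.\<close>

lemma blocks_le:
  assumes "u \<in> blocks m k N"
  shows "1 \<le> u" "u + k \<le> N * (m + k)"
proof -
  obtain i where i: "i < N" and u: "i * (m + k) + 1 \<le> u" "u \<le> i * (m + k) + m"
    using assms by (auto simp: blocks_def block_def)
  have "Suc i * (m + k) \<le> N * (m + k)"
    using i by (intro mult_le_mono1) simp
  with u show "1 \<le> u" "u + k \<le> N * (m + k)" by auto
qed

lemma blocks_disjoint: "blocks m k N \<inter> block m k N = {}"
  using blocks_le by (fastforce simp: block_def)

lemma card_blocks: "card (blocks m k N) = N * m"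
  by (induction N) (simp_all add: blocks_Suc card_Un_disjoint blocks_disjoint, simp add: blocks_def)

lemma block_mean_blocks:
  assumes "m \<ge> 1"
  shows "real N *\<^sub>R block_mean X (blocks m k N) \<omega> = (\<Sum>i<N. block_mean X (block m k i) \<omega>)"
proof -
  have "(\<Sum>u\<in>blocks m k N. X u \<omega>) = (\<Sum>i<N. \<Sum>u\<in>block m k i. X u \<omega>)"
    by (induction N) (simp_all add: blocks_Suc sum.union_disjoint blocks_disjoint, simp add: blocks_def)
  then show ?thesis
    using assms by (simp add: block_mean_def card_blocks scaleR_sum_right)
qed

subsection \<open>Comparison with independent blocks\<close>

lemma lipschitz_shift:
  assumes "lipschitz_wrt dist_Rd l G"
  shows "lipschitz_wrt dist_Rd l (\<lambda>x. G (z + x))"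
  using lipschitz_affine[OF assms, of 1 z] by (simp add: add.commute)

lemma P_mem: "lipschitz_wrt dist_Rd l G \<Longrightarrow> (\<lambda>\<omega>. G (z + M m \<omega>)) \<in> H"
  by (rule random_vector_lipschitz_mem[OF M_mem lipschitz_shift])

lemma lipschitz_P:
  assumes G: "lipschitz_wrt dist_Rd l G"
  shows "lipschitz_wrt dist_Rd l (P m G)"
proof (rule lipschitz_dist_RdI)
  fix x y
  have "\<bar>E (\<lambda>\<omega>. G (x + M m \<omega>)) - E (\<lambda>\<omega>. G (y + M m \<omega>))\<bar> \<le> E (\<lambda>_. l * norm1 (x - y))"
  proof (intro expectation_abs_diff_le P_mem[OF G] const_mem)
    show "\<bar>G (x + M m \<omega>) - G (y + M m \<omega>)\<bar> \<le> l * norm1 (x - y)" for \<omega>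
      using lipschitz_dist_RdD[OF G, of "x + M m \<omega>" "y + M m \<omega>"] by simp
  qed
  then show "P m G x - P m G y \<le> l * norm1 (x - y)"
    by (simp add: P_def const)
qed

lemma lipschitz_P_funpow: "lipschitz_wrt dist_Rd l G \<Longrightarrow> lipschitz_wrt dist_Rd l ((P m ^^ N) G)"
  by (induction N) (auto intro: lipschitz_P)

lemma P_mono:
  assumes "lipschitz_wrt dist_Rd l G" "lipschitz_wrt dist_Rd l' G'" "\<And>x. G x \<le> G' x"
  shows "P m G z \<le> P m G' z"
  unfolding P_def using assms by (intro mono P_mem) auto

lemma P_add_const:
  assumes "lipschitz_wrt dist_Rd l G"
  shows "P m (\<lambda>x. G x + b) z = P m G z + b"
  unfolding P_def by (rule expectation_add_const[OF P_mem[OF assms]])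

lemma lipschitz_add_const:
  "lipschitz_wrt dist_Rd l G \<Longrightarrow> lipschitz_wrt dist_Rd l (\<lambda>x. G x + b)"
  by (simp add: lipschitz_wrt_def)

lemma P_funpow_mono:
  assumes "lipschitz_wrt dist_Rd l G" "lipschitz_wrt dist_Rd l' G'" "\<And>x. G x \<le> G' x"
  shows "(P m ^^ N) G z \<le> (P m ^^ N) G' z"
proof (induction N arbitrary: z)
  case (Suc N)
  then show ?case
    by (simp, intro P_mono[OF lipschitz_P_funpow[OF assms(1)] lipschitz_P_funpow[OF assms(2)]])
qed (simp add: assms)

lemma P_funpow_add_const:
  assumes "lipschitz_wrt dist_Rd l G"
  shows "(P m ^^ N) (\<lambda>x. G x + b) = (\<lambda>z. (P m ^^ N) G z + b)"
proof (induction N)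
  case (Suc N)
  then show ?case
    by (auto simp: P_add_const[OF lipschitz_P_funpow[OF assms]])
qed simp

text \<open>Induction peels off the last block. Mixing speaks only of means over index sets, so the
  sum of the first \<open>N\<close> block means enters as \<open>N\<close> times the mean of their
  union; this makes the test function \<open>l * N\<close>-Lipschitz and the step cost
  \<open>c * l * N * exp (- \<alpha> * k)\<close>. Stationarity turns the inner expectation into
  \<open>P m G\<close>, to which the induction hypothesis applies, and the costs add up to at most
  the factor \<open>N^2\<close>.\<close>

lemma decoupling:
  assumes m: "m \<ge> 1" and G: "lipschitz_wrt dist_Rd l G" and l: "l > 0"
  shows "\<bar>E (\<lambda>\<omega>. G (real N *\<^sub>R block_mean X (blocks m k N) \<omega>)) - (P m ^^ N) G 0\<bar>
    \<le> c * l * (real N)\<^sup>2 * exp (- \<alpha> * k)"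
  using G
proof (induction N arbitrary: G)
  case 0
  show ?case by (simp add: const)
next
  case (Suc N)
  define T where "T = (\<lambda>\<omega>. real N *\<^sub>R block_mean X (blocks m k N) \<omega>)"
  have Suc_T: "real (Suc N) *\<^sub>R block_mean X (blocks m k (Suc N)) \<omega> = T \<omega> + block_mean X (block m k N) \<omega>" for \<omega>
    unfolding T_def block_mean_blocks[OF m] by simp
  have PG: "E (\<lambda>\<omega>'. G (z + block_mean X (block m k N) \<omega>')) = P m G z" for z
    using stationary_block_mean[OF lipschitz_shift[OF Suc.prems], of z "N * (m + k)" m] l
    by (simp add: P_def block_def)
  have step: "\<bar>E (\<lambda>\<omega>. G (T \<omega> + block_mean X (block m k N) \<omega>)) - E (\<lambda>\<omega>. P m G (T \<omega>))\<bar>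
      \<le> c * (l * N) * exp (- \<alpha> * k)"
  proof (cases "N = 0")
    \<comment> \<open>There are no earlier blocks, so mixing does not apply; \<open>T\<close> is
      zero and the two sides agree by stationarity alone.\<close>
    case True
    then show ?thesis using PG[of 0] by (simp add: T_def const)
  next
    case False
    define \<phi> where "\<phi> = (\<lambda>(x, y). G (real N *\<^sub>R x + y))"
    have "lipschitz_wrt dist_R2d (l * N) \<phi>"
      unfolding lipschitz_wrt_def
    proof (intro allI)
      fix a b :: "(real ^ 'd) \<times> (real ^ 'd)"
      have "\<bar>\<phi> a - \<phi> b\<bar> \<le> l * norm1 (real N *\<^sub>R (fst a - fst b) + (snd a - snd b))"
        using lipschitz_dist_RdD[OF Suc.prems, of "real N *\<^sub>R fst a + snd a" "real N *\<^sub>R fst b + snd b"]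
        by (simp add: \<phi>_def case_prod_beta algebra_simps)
      also have "\<dots> \<le> l * (real N * norm1 (fst a - fst b) + real N * norm1 (snd a - snd b))"
      proof (intro mult_left_mono order_trans[OF norm1_triangle] add_mono)
        show "norm1 (snd a - snd b) \<le> real N * norm1 (snd a - snd b)"
          using False norm1_nonneg[of "snd a - snd b"] by (simp add: mult_le_cancel_right1)
      qed (use l in auto)
      finally show "\<bar>\<phi> a - \<phi> b\<bar> \<le> l * N * dist_R2d a b"
        by (simp add: dist_R2d_def algebra_simps)
    qed
    moreover have ne: "blocks m k N \<noteq> {}" "block m k N \<noteq> {}"
      using card_blocks[of m k N] m False by (auto simp: block_def)
    moreover have "Min (block m k N) = N * (m + k) + 1"
      using m by (intro Min_eqI) (auto simp: block_def)
    moreover have max: "Max (blocks m k N) + k \<le> N * (m + k)"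
      using Max_in[OF finite_blocks ne(1)] by (intro blocks_le)
    ultimately have "\<bar>E (\<lambda>\<omega>. \<phi> (block_mean X (blocks m k N) \<omega>, block_mean X (block m k N) \<omega>))
          - E (\<lambda>\<omega>. E (\<lambda>\<omega>'. \<phi> (block_mean X (blocks m k N) \<omega>, block_mean X (block m k N) \<omega>')))\<bar>
        \<le> c * (l * N) * exp (- \<alpha> * \<bar>real (Min (block m k N)) - real (Max (blocks m k N))\<bar>)"
      using l False by (intro mixing[rule_format] conjI) (auto simp: block_def dest: blocks_le(1) simp del: Max_le_iff)
    also have "\<dots> \<le> c * (l * N) * exp (- \<alpha> * k)"
    proof -
      have "real (Max (blocks m k N) + k) \<le> real (Min (block m k N))"
        using \<open>Min _ = _\<close> max by (intro of_nat_mono) simp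
      then have "\<alpha> * real k \<le> \<alpha> * \<bar>real (Min (block m k N)) - real (Max (blocks m k N))\<bar>"
        using \<alpha>_pos by (intro mult_left_mono) auto
      then show ?thesis
        using c_pos l by (intro mult_left_mono) auto
    qed
    finally show ?thesis
      by (simp add: \<phi>_def PG T_def)
  qed
  have "\<bar>E (\<lambda>\<omega>. P m G (T \<omega>)) - (P m ^^ N) (P m G) 0\<bar> \<le> c * l * (real N)\<^sup>2 * exp (- \<alpha> * k)"
    unfolding T_def by (rule Suc.IH[OF lipschitz_P[OF Suc.prems]])
  moreover have "(P m ^^ N) (P m G) 0 = (P m ^^ Suc N) G 0"
    by (simp add: funpow_swap1)
  moreover have "c * (l * N) * exp (- \<alpha> * k) + c * l * (real N)\<^sup>2 * exp (- \<alpha> * k)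
      \<le> c * l * (real (Suc N))\<^sup>2 * exp (- \<alpha> * k)"
  proof -
    have "real N + (real N)\<^sup>2 \<le> (real (Suc N))\<^sup>2"
      by (simp add: power2_eq_square algebra_simps)
    then have "(c * l * exp (- \<alpha> * k)) * (real N + (real N)\<^sup>2) \<le> (c * l * exp (- \<alpha> * k)) * (real (Suc N))\<^sup>2"
      using c_pos l by (intro mult_left_mono) auto
    then show ?thesis by (simp add: algebra_simps)
  qed
  ultimately show ?case
    using step unfolding Suc_T by linarith
qed

end

subsection \<open>The limit mean set\<close>

text \<open>Raise \<open>x / (n + 1) \<le> exp (x / (n + 1))\<close> to the power
  \<open>n + 1\<close>. This trades the exponential mixing error for the powers of the gap needed
  below.\<close>

lemma exp_minus_le_inverse_power:
  fixes x :: real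
  assumes "x > 0"
  shows "exp (- x) \<le> (real (Suc n) / x) ^ Suc n"
proof -
  have "x / real (Suc n) \<le> exp (x / real (Suc n))"
    using exp_ge_add_one_self[of "x / real (Suc n)"] by linarith
  then have "(x / real (Suc n)) ^ Suc n \<le> exp (x / real (Suc n)) ^ Suc n"
    using assms by (intro power_mono) auto
  also have "\<dots> = exp x"
    using exp_of_nat_mult[of "Suc n" "x / real (Suc n)"] by (simp del: of_nat_Suc power_Suc)
  finally have "inverse (exp x) \<le> inverse ((x / real (Suc n)) ^ Suc n)"
    using assms by (intro le_imp_inverse_le) auto
  then show ?thesis
    by (simp add: exp_minus power_divide)
qed

context mixing_sequence
begin

lemma g_eq_P: "P m (\<lambda>x. v \<bullet> x) z = v \<bullet> z + g m v"
proof -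
  have "P m (\<lambda>x. v \<bullet> x) z = E (\<lambda>\<omega>. v \<bullet> M m \<omega> + v \<bullet> z)"
    by (simp add: P_def inner_add_right add.commute)
  then show ?thesis
    using expectation_add_const[OF random_vector_inner_mem[OF M_mem]] by (simp add: g_def)
qed

lemma g_scale: "a \<ge> 0 \<Longrightarrow> g m (a *\<^sub>R v) = a * g m v"
  using pos_homogeneous[OF random_vector_inner_mem[OF M_mem]] by (simp add: g_def)

text \<open>In \<open>g_double\<close>, two deletions of \<open>k\<close> indices cost
  \<open>2 * A\<close> each, and the decoupling of two blocks costs
  \<open>2 * c / \<alpha>\<close>.\<close>

definition C\<^sub>1 :: real
  where "C\<^sub>1 = 4 * A + 2 * c / \<alpha>"

lemma C\<^sub>1_nonneg: "C\<^sub>1 \<ge> 0"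
  using A_nonneg c_pos \<alpha>_pos by (simp add: C\<^sub>1_def)

text \<open>
  Two blocks of length \<open>m\<close> separated by a gap \<open>k\<close> of order \<open>sqrt m\<close> are nearly independent, and the
  gap changes the mean only by \<open>k / m\<close>.
\<close>

lemma g_double:
  assumes m: "m \<ge> 1"
  shows "\<bar>g (2 * m) v - g m v\<bar> \<le> norm v * (C\<^sub>1 / sqrt m)"
proof (cases "v = 0")
  case True
  then show ?thesis by (simp add: g_def const)
next
  case False
  define k where "k = nat \<lceil>sqrt m\<rceil>"
  have sqrt_m: "sqrt m \<ge> 1" using m by simp
  have k: "sqrt m \<le> k" "k \<le> 2 * sqrt m"
    using sqrt_m unfolding k_def by linarith+
  have k_pos: "k > 0"
    using k sqrt_m by linarith
  define B where "B = blocks m k 2"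
  have B: "B \<subseteq> {1..2 * m + k}" "card B = 2 * m" "B \<noteq> {}"
    using blocks_le[of _ m k 2] m card_blocks[of m k 2] by (fastforce simp: B_def)+
  have small: "2 * A * (real (2 * m + k) - real (2 * m)) / real (2 * m + k) \<le> 2 * A / sqrt m"
  proof -
    have "2 * A * (real (2 * m + k) - real (2 * m)) / real (2 * m + k) \<le> 2 * A * (2 * sqrt m) / (2 * m)"
      using k A_nonneg m by (intro frac_le mult_left_mono mult_nonneg_nonneg) auto
    also have "\<dots> = 2 * A * (sqrt m / (sqrt m * sqrt m))"
      by simp
    also have "\<dots> = 2 * A / sqrt m"
      using sqrt_m by (simp del: real_sqrt_mult_self)
    finally show ?thesis .
  qed
  \<comment> \<open>The mean over \<open>2 * m + k\<close> terms is the intermediary: deleting the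
    middle gap gives \<open>B\<close>, deleting the last \<open>k\<close> indices gives
    \<open>{1..2 * m}\<close>.\<close>
  have 1: "\<bar>g (2 * m + k) v - E (\<lambda>\<omega>. v \<bullet> block_mean X B \<omega>)\<bar> \<le> norm v * (2 * A / sqrt m)"
    using block_mean_compare[OF lipschitz_inner[of v] _ B(1,3)] mult_left_mono[OF small, of "norm v"] B(2)
    by (simp add: g_def)
  have 2: "\<bar>g (2 * m + k) v - g (2 * m) v\<bar> \<le> norm v * (2 * A / sqrt m)"
    using block_mean_compare[OF lipschitz_inner[of v], of "{1..2 * m}" "2 * m + k"] m
      mult_left_mono[OF small, of "norm v"]
    by (simp add: g_def)
  \<comment> \<open>The factor \<open>1/2\<close> compensates that \<open>decoupling\<close> treats
    twice the mean over \<open>B\<close>. For linear \<open>G\<close>, each application of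
    \<open>P m\<close> merely adds \<open>g m v / 2\<close>.\<close>
  define G where "G = (\<lambda>x. ((1/2) *\<^sub>R v) \<bullet> x)"
  have lip: "lipschitz_wrt dist_Rd (norm v / 2) G"
    using lipschitz_inner[of "(1/2) *\<^sub>R v"] by (simp add: G_def)
  have "P m G = (\<lambda>z. G z + g m v / 2)"
    unfolding G_def by (rule ext) (simp add: g_eq_P g_scale)
  then have "(P m ^^ 2) G 0 = g m v"
    using P_add_const[OF lip] by (simp add: numeral_2_eq_2) (simp add: G_def)
  moreover have "G (real 2 *\<^sub>R block_mean X B \<omega>) = v \<bullet> block_mean X B \<omega>" for \<omega>
    by (simp add: G_def)
  ultimately have 3: "\<bar>E (\<lambda>\<omega>. v \<bullet> block_mean X B \<omega>) - g m v\<bar> \<le> 2 * c * norm v * exp (- \<alpha> * k)"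
    using decoupling[OF m lip, of 2 k] False by (simp add: B_def algebra_simps)
  have "exp (- \<alpha> * k) \<le> 1 / (\<alpha> * k)"
    using exp_minus_le_inverse_power[of "\<alpha> * k" 0] k_pos \<alpha>_pos by simp
  also have "\<dots> \<le> 1 / (\<alpha> * sqrt m)"
    using k(1) k_pos m \<alpha>_pos by (intro divide_left_mono mult_left_mono mult_pos_pos) auto
  finally have "2 * c * norm v * exp (- \<alpha> * k) \<le> 2 * c * norm v * (1 / (\<alpha> * sqrt m))"
    using c_pos by (intro mult_left_mono) auto
  with 1 2 3 have "\<bar>g (2 * m) v - g m v\<bar>
      \<le> norm v * (2 * A / sqrt m) + norm v * (2 * A / sqrt m) + 2 * c * norm v * (1 / (\<alpha> * sqrt m))"
    by linarith
  also have "\<dots> = norm v * (C\<^sub>1 / sqrt m)"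
    using sqrt_m \<alpha>_pos by (simp add: C\<^sub>1_def field_simps)
  finally show ?thesis .
qed

text \<open>Telescoping over doublings. Since \<open>sqrt 2 \<ge> 4 / 3\<close>, passing from
  \<open>L\<close> to \<open>2 * L\<close> lowers \<open>1 / sqrt L\<close> by at least a quarter of
  itself, so \<open>4 * C\<^sub>1\<close> times this drop pays for the error in
  \<open>g_double\<close>.\<close>

lemma g_double_power:
  assumes m: "m \<ge> 1"
  shows "g m v \<le> g (2 ^ i * m) v + norm v * (4 * C\<^sub>1) * (1 / sqrt m - 1 / sqrt (2 ^ i * m))"
proof (induction i)
  case (Suc i)
  define L where "L = 2 ^ i * m"
  have L: "L \<ge> 1" using m by (simp add: L_def)
  have "sqrt 2 \<ge> 4 / 3"
    by (rule real_le_rsqrt) (simp add: power2_eq_square)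
  then have "1 / sqrt (2 * L) \<le> (3 / 4) / sqrt L"
    using L by (simp add: real_sqrt_mult field_simps)
  then have "norm v * (4 * C\<^sub>1) * ((1 / 4) / sqrt L) \<le> norm v * (4 * C\<^sub>1) * (1 / sqrt L - 1 / sqrt (2 * L))"
    using C\<^sub>1_nonneg by (intro mult_left_mono) (simp_all add: field_simps)
  then have "norm v * (C\<^sub>1 / sqrt L) \<le> norm v * (4 * C\<^sub>1) * (1 / sqrt L - 1 / sqrt (2 * L))"
    by simp
  moreover have "g L v \<le> g (2 * L) v + norm v * (C\<^sub>1 / sqrt L)"
    using g_double[OF L, of v] by simp
  moreover have "g m v \<le> g L v + norm v * (4 * C\<^sub>1) * (1 / sqrt m - 1 / sqrt L)"
    using Suc by (simp add: L_def)
  ultimately have "g m v \<le> g (2 * L) v + norm v * (4 * C\<^sub>1) * (1 / sqrt m - 1 / sqrt (2 * L))"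
    by (simp add: algebra_simps)
  then show ?case by (simp add: L_def mult.assoc)
qed simp

text \<open>Blocks of length \<open>j\<close> with gap zero tile \<open>{1..q * j}\<close>;
  subadditivity and stationarity do the rest.\<close>

lemma g_mult_le:
  assumes q: "q \<ge> 1" and j: "j \<ge> 1"
  shows "g (q * j) v \<le> g j v"
proof -
  have "blocks j 0 q \<subseteq> {1..q * j}"
    using blocks_le[of _ j 0 q] by auto
  then have blocks: "blocks j 0 q = {1..q * j}"
    by (rule card_subset_eq[rotated]) (auto simp: card_blocks)
  have "block j 0 i \<subseteq> {1..}" for i
    by (auto simp: block_def)
  note mem = random_vector_inner_mem[OF block_mean_X_mem[OF this]]
  have "q * g (q * j) v = E (\<lambda>\<omega>. real q * (v \<bullet> M (q * j) \<omega>))"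
    using pos_homogeneous[OF random_vector_inner_mem[OF M_mem], of "real q"] by (simp add: g_def)
  also have "(\<lambda>\<omega>. real q * (v \<bullet> M (q * j) \<omega>)) = (\<lambda>\<omega>. \<Sum>i<q. v \<bullet> block_mean X (block j 0 i) \<omega>)"
    using block_mean_blocks[OF j, of q 0] unfolding blocks
    by (simp flip: inner_scaleR_right add: inner_sum_right)
  also have "E \<dots> \<le> (\<Sum>i<q. E (\<lambda>\<omega>. v \<bullet> block_mean X (block j 0 i) \<omega>))"
    by (rule expectation_sum_le[OF mem])
  also have "\<dots> = (\<Sum>i<q. g j v)"
    unfolding g_def block_def
    by (intro sum.cong refl stationary_block_mean[OF lipschitz_inner]) auto
  finally show ?thesis using q by simp
qed

text \<open>Truncating \<open>L\<close> to a multiple of \<open>j\<close> deletes fewer than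
  \<open>j\<close> indices, and \<open>g_mult_le\<close> handles the multiple.\<close>

lemma g_le_div:
  assumes "1 \<le> j" "j \<le> L"
  shows "g L v \<le> g j v + norm v * (2 * A * j / L)"
proof -
  define q where "q = L div j"
  have "L mod j < j"
    using assms by simp
  then have q: "L < q * j + j" "q \<ge> 1" "q * j \<le> L"
    unfolding q_def using assms div_mult_mod_eq[of L j]
    by (linarith, simp_all add: Suc_le_eq div_greater_zero_iff)
  have sub: "{1..q * j} \<subseteq> {1..L}" "{1..q * j} \<noteq> {}"
    using q assms by auto
  have "\<bar>g L v - g (q * j) v\<bar> \<le> norm v * (2 * A * (real L - real (q * j)) / L)"
    using block_mean_compare[OF lipschitz_inner[of v] _ sub] by (simp add: g_def)
  also have "\<dots> \<le> norm v * (2 * A * j / L)"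
  proof -
    have "real L \<le> real (q * j + j)"
      using q(1) by (intro of_nat_mono) simp
    then show ?thesis
      using A_nonneg by (intro mult_left_mono divide_right_mono) auto
  qed
  finally show ?thesis
    using g_mult_le[OF q(2) assms(1), of v] by simp
qed

text \<open>Pass from \<open>m\<close> to \<open>2 ^ i * m\<close> by doubling and from there to
  \<open>j\<close> by division. The division error vanishes as \<open>i\<close> grows, while the
  doubling error stays below \<open>4 * C\<^sub>1 / sqrt m\<close>. As \<open>j\<close> is
  arbitrary, no mean set can be much smaller than that of \<open>m\<close>.\<close>

lemma g_le:
  assumes m: "m \<ge> 1" and j: "j \<ge> 1"
  shows "g m v \<le> g j v + norm v * (4 * C\<^sub>1 / sqrt m)"
proof (rule LIMSEQ_le_const)
  define b where "b = (\<lambda>i. g j v + norm v * (4 * C\<^sub>1 / sqrt m) + norm v * (2 * A * j / m) * (1/2) ^ i)"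
  have "b \<longlonglongrightarrow> g j v + norm v * (4 * C\<^sub>1 / sqrt m) + norm v * (2 * A * j / m) * 0"
    unfolding b_def by (intro tendsto_intros LIMSEQ_realpow_zero) auto
  then show "b \<longlonglongrightarrow> g j v + norm v * (4 * C\<^sub>1 / sqrt m)" by simp
  have "g m v \<le> b i" if i: "j \<le> i" for i
  proof -
    have "j \<le> 2 ^ i * 1"
      using i less_exp[of i] by (metis less_imp_le mult_1_right order_trans)
    also have "\<dots> \<le> 2 ^ i * m"
      using m by (intro mult_le_mono2)
    finally have "j \<le> 2 ^ i * m" .
    from g_le_div[OF j this]
    have "g (2 ^ i * m) v \<le> g j v + norm v * (2 * A * j / (2 ^ i * m))" by simp
    also have "norm v * (2 * A * j / (2 ^ i * m)) = norm v * (2 * A * j / m) * (1/2) ^ i"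
      by (simp add: power_divide)
    finally have "g (2 ^ i * m) v \<le> g j v + norm v * (2 * A * j / m) * (1/2) ^ i" .
    moreover have "norm v * (4 * C\<^sub>1) * (1 / sqrt m - 1 / sqrt (2 ^ i * m)) \<le> norm v * (4 * C\<^sub>1) * (1 / sqrt m)"
      using C\<^sub>1_nonneg by (intro mult_left_mono) auto
    ultimately show ?thesis
      using g_double_power[OF m, of v i] by (simp add: b_def)
  qed
  then show "\<exists>N. \<forall>i\<ge>N. g m v \<le> b i" by blast
qed

section \<open>The intersection of the mean sets and its support function\<close>

definition K :: "(real ^ 'd) set"
  where "K = limit_mean_set H E X"

lemma mean_set_eq: "mean_set H E X n = mean_values (M n)"
proof -
  have eq: "(1 / real n) *\<^sub>R (\<Sum>k=1..n. vec_expectation F (X k)) = vec_expectation F (M n)"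
    if "F \<in> dominated_linear_expectations H E" for F
  proof -
    have F: "linear_expectation H F"
      using that by (simp add: dominated_linear_expectations_def)
    have "F (\<lambda>\<omega>. \<Sum>k=1..n. (1 / real n) * (X k \<omega> $ i)) = (\<Sum>k=1..n. (1 / real n) * F (\<lambda>\<omega>. X k \<omega> $ i))" for i
      using X_mem by (intro linear_expectation.expectation_sum[OF F]) (auto simp: random_vectors_def)
    then show ?thesis
      by (simp add: vec_eq_iff vec_expectation_def block_mean_def sum_divide_distrib)
  qed
  then show ?thesis
    unfolding mean_set_def mean_values_def by (intro Collect_cong ex_cong1) (auto simp: eq)
qed

lemma K_eq: "K = (\<Inter>n\<in>{1..}. mean_values (M n))"
  by (simp add: K_def limit_mean_set_def mean_set_eq)

lemma inner_K_le: "y \<in> K \<Longrightarrow> n \<ge> 1 \<Longrightarrow> v \<bullet> y \<le> g n v"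
  using mean_values_iff[OF M_mem] by (auto simp: K_eq g_def)

lemma convex_K: "convex K"
  unfolding K_eq by (intro convex_INT convex_mean_values M_mem)

lemma compact_K: "compact K"
proof -
  have "closed K"
    unfolding K_eq by (intro closed_INT ballI compact_imp_closed compact_mean_values M_mem)
  then have "compact (mean_values (M 1) \<inter> K)"
    by (intro compact_Int_closed compact_mean_values M_mem)
  moreover have "mean_values (M 1) \<inter> K = K"
    by (auto simp: K_eq)
  ultimately show ?thesis by simp
qed

text \<open>
  The mean sets decrease along divisibility, hence along the factorials, so that a maximiser of \<open>v\<close>
  over their intersection is obtained by compactness.
\<close>

lemma K_support:
  assumes m: "m \<ge> 1"
  obtains y where "y \<in> K" "g m v \<le> v \<bullet> y + norm v * (4 * C\<^sub>1 / sqrt m)"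
proof -
  define b where "b = g m v - norm v * (4 * C\<^sub>1 / sqrt m)"
  \<comment> \<open>The half-space leaves every factorial mean set nonempty: its maximal value of
    \<open>v\<close> is \<open>g (fact j) v\<close>, which is at least \<open>b\<close> by
    \<open>g_le\<close>. A common point of all \<open>S j\<close> is therefore the desired
    near-maximiser.\<close>
  define S where "S = (\<lambda>j. mean_values (M (fact j)) \<inter> {x. v \<bullet> x \<ge> b})"
  have dvd: "mean_values (M n) \<subseteq> mean_values (M j)" if "j dvd n" "n \<ge> 1" for j n
  proof -
    obtain q where q: "n = j * q" using \<open>j dvd n\<close> by (elim dvdE)
    then have le: "g n w \<le> g j w" for w
      using g_mult_le[of q j w] \<open>n \<ge> 1\<close> by (simp add: mult.commute)
    show ?thesis
    proof
      fix x assume "x \<in> mean_values (M n)"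
      then have "w \<bullet> x \<le> g n w" for w
        using mean_values_iff[OF M_mem, of x n] by (simp add: g_def)
      then have "w \<bullet> x \<le> g j w" for w
        using le[of w] order_trans by blast
      then show "x \<in> mean_values (M j)"
        using mean_values_iff[OF M_mem, of x j] by (simp add: g_def)
    qed
  qed
  have "\<Inter>(range S) \<noteq> {}"
  proof (rule compact_nest)
    show "compact (S j)" for j
      unfolding S_def by (intro compact_Int_closed compact_mean_values M_mem closed_halfspace_ge)
    show "S j \<noteq> {}" for j
    proof -
      obtain x where "x \<in> mean_values (M (fact j))" "v \<bullet> x = g (fact j) v"
        using mean_values_attain[OF M_mem] unfolding g_def by blast
      moreover have "b \<le> g (fact j) v"
        using g_le[OF m, of "fact j" v] by (simp add: b_def)
      ultimately show ?thesis by (auto simp: S_def)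
    qed
    show "S j \<subseteq> S i" if "i \<le> j" for i j
      using dvd[of "fact i" "fact j"] that by (auto simp: S_def fact_dvd)
  qed
  then obtain y where y: "\<And>j. y \<in> S j" by auto
  have "y \<in> mean_values (M n)" if "n \<ge> 1" for n
    using y[of n] dvd[of n "fact n"] that by (auto simp: S_def dvd_fact)
  then have "y \<in> K" by (auto simp: K_eq)
  moreover have "g m v \<le> v \<bullet> y + norm v * (4 * C\<^sub>1 / sqrt m)"
    using y[of 0] by (simp add: S_def b_def)
  ultimately show thesis by (rule that)
qed

end

subsection \<open>Law of large numbers for independent blocks\<close>

text \<open>The product norm \<open>norm (s, x)\<close> equals \<open>sqrt (s^2 + |x|^2)\<close>, a
  smoothing of the norm at scale \<open>s\<close>; in this form its convexity and Lipschitz bound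
  are instances of the triangle inequality.\<close>

lemma norm_Pair_mono: "norm x \<le> norm y \<Longrightarrow> norm (s, x) \<le> norm (s, y)"
  by (simp add: norm_Pair power_mono)

lemma norm_Pair_norm: "norm (s, norm x) = norm (s, x)"
  by (simp add: norm_Pair)

lemma norm_Pair_diff_le: "norm (s :: real, x) - norm (s, y) \<le> norm (x - y)"
  using norm_triangle_ineq2[of "(s, x)" "(s, y)"] by (simp add: norm_Pair)

lemma norm_Pair_ge: "s \<le> norm (s :: real, x)"
  using norm_fst_le[of s x] by simp

lemma norm_Pair_minus_le:
  fixes x :: "'a :: real_inner"
  assumes "s > 0"
  shows "norm (s :: real, x) - s \<le> (norm x)\<^sup>2 / (2 * s)"
proof -
  have "norm (s, x) * (2 * s) \<le> (norm (s, x))\<^sup>2 + s\<^sup>2"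
    using zero_le_power2[of "norm (s, x) - s"] by (simp add: power2_eq_square algebra_simps)
  also have "\<dots> = (norm x)\<^sup>2 + 2 * s\<^sup>2"
    by (simp add: norm_Pair)
  finally show ?thesis
    using assms by (simp add: field_simps power2_eq_square)
qed

text \<open>
  A second-order Taylor estimate for \<open>sqrt (s^2 + |v|^2)\<close> whose error term, unlike \<open>|w|^2 / s\<close>, is
  Lipschitz in \<open>w\<close>: only for Lipschitz functions are expectations transported by stationarity.
\<close>

lemma norm_Pair_add_le:
  fixes v w :: "'a :: real_inner"
  assumes s: "s > 0"
  shows "norm (s, v + w) \<le> norm (s, v) + v \<bullet> w / norm (s, v) + 3 * (norm (s, w) - s)"
proof -
  define a where "a = norm (s, v)"
  define b where "b = norm (s, w)"
  define d where "d = norm (s, v + w)"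
  have a: "a \<ge> s" and b: "b \<ge> s"
    by (simp_all add: a_def b_def norm_Pair_ge)
  have a2: "a\<^sup>2 = s\<^sup>2 + (norm v)\<^sup>2" and b2: "b\<^sup>2 = s\<^sup>2 + (norm w)\<^sup>2"
    by (simp_all add: a_def b_def norm_Pair)
  have d2: "d\<^sup>2 = a\<^sup>2 + 2 * (v \<bullet> w) + (b\<^sup>2 - s\<^sup>2)"
  proof -
    have "d\<^sup>2 = s\<^sup>2 + (norm (v + w))\<^sup>2"
      by (simp add: d_def norm_Pair)
    then show ?thesis
      by (simp add: a2 b2 power2_norm_eq_inner inner_add_left inner_add_right inner_commute)
  qed
  show ?thesis
  proof (cases "b \<le> 3 * s")
    \<comment> \<open>Small increments: \<open>2 * a * d \<le> a^2 + d^2\<close> linearises the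
      square root, and \<open>b + s \<le> 4 * s \<le> 4 * a\<close> controls the quadratic
      term.\<close>
    case True
    have "2 * a * d \<le> a\<^sup>2 + d\<^sup>2"
      using zero_le_power2[of "a - d"] by (simp add: power2_eq_square algebra_simps)
    moreover have "(b - s) * (b + s) = b\<^sup>2 - s\<^sup>2"
      by (simp add: power2_eq_square algebra_simps)
    ultimately have "2 * a * d \<le> 2 * a\<^sup>2 + 2 * (v \<bullet> w) + (b - s) * (b + s)"
      unfolding d2 by linarith
    also have "(b - s) * (b + s) \<le> (b - s) * (4 * a)"
      using a b True by (intro mult_left_mono) auto
    finally have "a * d \<le> a * (a + v \<bullet> w / a + 2 * (b - s))"
      using a s by (simp add: power2_eq_square algebra_simps)
    then have "d \<le> a + v \<bullet> w / a + 2 * (b - s)"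
      using a s by simp
    also have "\<dots> \<le> a + v \<bullet> w / a + 3 * (b - s)"
      using b by simp
    finally show ?thesis by (simp add: a_def b_def d_def)
  next
    \<comment> \<open>Large increments: the crude bounds \<open>d \<le> a + b\<close> and
      \<open>v \<bullet> w / a \<ge> - b\<close> suffice, because
      \<open>2 * b \<le> 3 * (b - s)\<close>.\<close>
    case False
    have "norm w \<le> b" "norm v \<le> a"
      using norm_snd_le[of w s] norm_snd_le[of v s] by (simp_all add: a_def b_def)
    have "- (v \<bullet> w) \<le> norm v * norm w"
      using norm_cauchy_schwarz[of "- v" w] by simp
    also have "\<dots> \<le> a * b"
      using \<open>norm w \<le> b\<close> \<open>norm v \<le> a\<close> a s by (intro mult_mono) auto
    finally have "- b \<le> v \<bullet> w / a"
      using a s by (simp add: field_simps)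
    moreover have "d \<le> a + b"
      using norm_Pair_diff_le[of s "v + w" v] \<open>norm w \<le> b\<close> by (simp add: a_def d_def)
    ultimately have "d \<le> a + v \<bullet> w / a + 3 * (b - s)"
      using False by simp
    then show ?thesis by (simp add: a_def b_def d_def)
  qed
qed

lemma lipschitz_norm_Pair: "lipschitz_wrt dist_Rd 1 (\<lambda>x. norm (s :: real, x - y))"
proof (rule lipschitz_dist_Rd_normI)
  show "norm (s, x - y) - norm (s, z - y) \<le> 1 * norm (x - z)" for x z
    using norm_Pair_diff_le[of s "x - y" "z - y"] by simp
qed simp

lemma lipschitz_norm_Pair_infdist: "lipschitz_wrt dist_Rd 1 (\<lambda>x. norm (s :: real, infdist x S))"
proof (rule lipschitz_dist_Rd_normI)
  fix x z :: "real ^ 'a"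
  show "norm (s, infdist x S) - norm (s, infdist z S) \<le> 1 * norm (x - z)"
    using norm_Pair_diff_le[of s "infdist x S" "infdist z S"] infdist_triangle_abs[of x S z]
    by (simp add: dist_norm)
qed simp

lemma lipschitz_uminus: "lipschitz_wrt D l f \<Longrightarrow> lipschitz_wrt D l (\<lambda>x. - f x)"
  by (simp add: lipschitz_wrt_def abs_minus_commute)

lemma lipschitz_scale: "lipschitz_wrt D l f \<Longrightarrow> a \<ge> 0 \<Longrightarrow> lipschitz_wrt D (a * l) (\<lambda>x. a * f x)"
  by (auto simp: lipschitz_wrt_def abs_mult mult.assoc simp flip: right_diff_distrib intro!: mult_left_mono)

section \<open>Iterating the one-step operator along test functions\<close>

context mixing_sequence
begin

lemma P_scale:
  assumes "lipschitz_wrt dist_Rd l G" "a \<ge> 0"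
  shows "P m (\<lambda>x. a * G x) z = a * P m G z"
  unfolding P_def by (rule pos_homogeneous[OF P_mem[OF assms(1)] assms(2)])

lemma P_funpow_scale:
  assumes "lipschitz_wrt dist_Rd l G" "a \<ge> 0"
  shows "(P m ^^ N) (\<lambda>x. a * G x) = (\<lambda>z. a * (P m ^^ N) G z)"
proof (induction N)
  case (Suc N)
  then show ?case
    by (auto simp: P_scale[OF lipschitz_P_funpow[OF assms(1)] assms(2)])
qed simp

text \<open>\<open>F\<close> is a supersolution of the backward recursion up to
  \<open>\<eta>\<close>: the innermost application of \<open>P m\<close> lowers the index by one at
  cost \<open>\<eta>\<close>, and monotonicity and translation by constants carry this through the
  remaining iterates.\<close>

lemma P_funpow_le:
  assumes lip: "\<And>j. lipschitz_wrt dist_Rd l (F j)"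
    and step: "\<And>j z. P m (F (Suc j)) z \<le> F j z + \<eta>"
  shows "(P m ^^ N) (F N) z \<le> F 0 z + N * \<eta>"
proof (induction N arbitrary: z)
  case (Suc N)
  have "(P m ^^ Suc N) (F (Suc N)) z = (P m ^^ N) (P m (F (Suc N))) z"
    by (simp add: funpow_swap1)
  also have "\<dots> \<le> (P m ^^ N) (\<lambda>z. F N z + \<eta>) z"
    by (rule P_funpow_mono[OF lipschitz_P[OF lip] lipschitz_add_const[OF lip] step])
  also have "\<dots> = (P m ^^ N) (F N) z + \<eta>"
    by (simp add: P_funpow_add_const[OF lip])
  also have "\<dots> \<le> F 0 z + Suc N * \<eta>"
    using Suc.IH[of z] by (simp add: algebra_simps)
  finally show ?case .
qed simp

lemma P_funpow_ge:
  assumes lip: "\<And>j. lipschitz_wrt dist_Rd l (F j)"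
    and step: "\<And>j z. F j z - \<eta> \<le> P m (F (Suc j)) z"
  shows "F 0 z - N * \<eta> \<le> (P m ^^ N) (F N) z"
proof (induction N arbitrary: z)
  case (Suc N)
  have "F 0 z - Suc N * \<eta> \<le> (P m ^^ N) (F N) z + - \<eta>"
    using Suc.IH[of z] by (simp add: algebra_simps)
  also have "\<dots> = (P m ^^ N) (\<lambda>z. F N z + - \<eta>) z"
    by (simp only: P_funpow_add_const[OF lip])
  also have "\<dots> \<le> (P m ^^ N) (P m (F (Suc N))) z"
  proof (rule P_funpow_mono[OF lipschitz_add_const[OF lip] lipschitz_P[OF lip]])
    show "F N x + - \<eta> \<le> P m (F (Suc N)) x" for x
      using step[of N x] by simp
  qed
  also have "\<dots> = (P m ^^ Suc N) (F (Suc N)) z"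
    by (simp add: funpow_swap1)
  finally show ?case .
qed simp

definition S\<^sub>2 :: real
  where "S\<^sub>2 = E (\<lambda>\<omega>. (norm1 (X 1 \<omega>))\<^sup>2)"

lemma S\<^sub>2_nonneg: "S\<^sub>2 \<ge> 0"
  using mono[OF zero_mem square_mem] by (simp add: S\<^sub>2_def const)

text \<open>Squares are not Lipschitz, so stationarity cannot carry the second moment of
  \<open>X 1\<close> to \<open>M m\<close>. Instead convexity reduces the Lipschitz function
  \<open>h\<close> to the single terms, stationarity moves these to \<open>X 1\<close>, and only
  there is \<open>h\<close> compared with a square.\<close>

lemma expectation_norm_Pair_M_le:
  assumes s: "s > 0" and m: "m \<ge> 1"
  shows "E (\<lambda>\<omega>. norm (s, M m \<omega> - y) - s) \<le> (S\<^sub>2 + (norm y)\<^sup>2) / s"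
proof -
  define h where "h = (\<lambda>x. norm (s, x - y) + - s)"
  have lip: "lipschitz_wrt dist_Rd 1 h"
    unfolding h_def by (rule lipschitz_add_const[OF lipschitz_norm_Pair])
  have hX: "(\<lambda>\<omega>. h (X k \<omega>)) \<in> H" if "k \<in> {1..m}" for k
    using that by (intro random_vector_lipschitz_mem[OF X_mem lip]) auto
  have jensen: "h (M m \<omega>) \<le> (\<Sum>k=1..m. (1 / m) * h (X k \<omega>))" for \<omega>
  proof -
    \<comment> \<open>Jensen's inequality here is the triangle inequality for pairs, since the
      average of the constant first components is again \<open>s\<close>.\<close>
    have "(\<Sum>k=1..m. (1 / m) *\<^sub>R (s, X k \<omega> - y)) = (s, M m \<omega> - y)"
      using m by (simp add: prod_eq_iff fst_sum snd_sum block_mean_def sum_subtractf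
          sum_constant_scaleR scaleR_diff_right flip: scaleR_sum_right del: sum_constant)
    then have "norm (s, M m \<omega> - y) \<le> (\<Sum>k=1..m. norm ((1 / real m) *\<^sub>R (s, X k \<omega> - y)))"
      using norm_sum[of "\<lambda>k. (1 / real m) *\<^sub>R (s, X k \<omega> - y)" "{1..m}"] by simp
    also have "\<dots> = (\<Sum>k=1..m. (1 / m) * norm (s, X k \<omega> - y))"
      by (intro sum.cong refl, subst norm_scaleR) simp
    finally show ?thesis
      using m by (simp add: h_def right_diff_distrib sum_subtractf)
  qed
  have "E (\<lambda>\<omega>. h (M m \<omega>)) \<le> E (\<lambda>\<omega>. \<Sum>k=1..m. (1 / m) * h (X k \<omega>))"
    using jensen by (intro mono random_vector_lipschitz_mem[OF M_mem lip] sum_mem scale_mem hX) auto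
  also have "\<dots> \<le> (\<Sum>k=1..m. E (\<lambda>\<omega>. (1 / m) * h (X k \<omega>)))"
    by (intro expectation_sum_le scale_mem hX)
  also have "\<dots> = (\<Sum>k=1..m. (1 / m) * E (\<lambda>\<omega>. h (X 1 \<omega>)))"
  proof (rule sum.cong[OF refl])
    fix k assume k: "k \<in> {1..m}"
    have "E (\<lambda>\<omega>. (1 / m) * h (X k \<omega>)) = (1 / m) * E (\<lambda>\<omega>. h (X k \<omega>))"
      by (rule pos_homogeneous[OF hX[OF k]]) simp
    also have "E (\<lambda>\<omega>. h (X k \<omega>)) = E (\<lambda>\<omega>. h (X 1 \<omega>))"
      using k by (intro stationary_single[OF lip]) auto
    finally show "E (\<lambda>\<omega>. (1 / m) * h (X k \<omega>)) = (1 / m) * E (\<lambda>\<omega>. h (X 1 \<omega>))" .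
  qed
  also have "\<dots> = E (\<lambda>\<omega>. h (X 1 \<omega>))"
    using m by simp
  also have "\<dots> \<le> E (\<lambda>\<omega>. (1 / s) * ((norm1 (X 1 \<omega>))\<^sup>2 + (norm y)\<^sup>2))"
  proof (intro mono hX scale_mem add_mem square_mem const_mem allI)
    fix \<omega>
    have "(norm (X 1 \<omega> - y))\<^sup>2 \<le> (norm (X 1 \<omega>) + norm y)\<^sup>2"
      by (intro power_mono norm_triangle_ineq4) simp
    also have "\<dots> \<le> 2 * (norm (X 1 \<omega>))\<^sup>2 + 2 * (norm y)\<^sup>2"
      using zero_le_power2[of "norm (X 1 \<omega>) - norm y"] by (simp add: power2_eq_square algebra_simps)
    also have "(norm (X 1 \<omega>))\<^sup>2 \<le> (norm1 (X 1 \<omega>))\<^sup>2"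
      by (intro power_mono norm_le_norm1) simp
    finally have "(norm (X 1 \<omega> - y))\<^sup>2 / (2 * s) \<le> (2 * (norm1 (X 1 \<omega>))\<^sup>2 + 2 * (norm y)\<^sup>2) / (2 * s)"
      using s by (intro divide_right_mono) auto
    with norm_Pair_minus_le[OF s, of "X 1 \<omega> - y"]
    show "h (X 1 \<omega>) \<le> (1 / s) * ((norm1 (X 1 \<omega>))\<^sup>2 + (norm y)\<^sup>2)"
      using s by (simp add: h_def field_simps)
  qed (use m in auto)
  also have "\<dots> = (1 / s) * E (\<lambda>\<omega>. (norm1 (X 1 \<omega>))\<^sup>2 + (norm y)\<^sup>2)"
    using s by (intro pos_homogeneous add_mem square_mem const_mem) auto
  also have "\<dots> = (S\<^sub>2 + (norm y)\<^sup>2) / s"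
    by (simp only: expectation_add_const[OF square_mem] S\<^sub>2_def times_divide_eq_left mult_1_left)
  finally show ?thesis by (simp add: h_def)
qed

lemma norm_Pair_M_mem: "(\<lambda>\<omega>. norm (s :: real, M m \<omega> - y) - s) \<in> H"
  using random_vector_lipschitz_mem[OF M_mem lipschitz_add_const[OF lipschitz_norm_Pair[of s y], of "- s"], of m]
  by simp

lemma inner_M_mem: "(\<lambda>\<omega>. v \<bullet> (M m \<omega> - y) / a) \<in> H"
  using add_mem[OF scale_mem[OF random_vector_inner_mem[OF M_mem[of m], of v], of "1 / a"] const_mem[of "- (v \<bullet> y) / a"]]
  by (simp add: inner_diff_right diff_divide_distrib)

lemma expectation_inner_M:
  assumes "a > 0"
  shows "E (\<lambda>\<omega>. v \<bullet> (M m \<omega> - y) / a) = (g m v - v \<bullet> y) / a"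
proof -
  have "E (\<lambda>\<omega>. v \<bullet> (M m \<omega> - y) / a) = E (\<lambda>\<omega>. (1 / a) * (v \<bullet> M m \<omega> + - (v \<bullet> y)))"
    by (simp add: inner_diff_right)
  also have "\<dots> = (1 / a) * E (\<lambda>\<omega>. v \<bullet> M m \<omega> + - (v \<bullet> y))"
    using assms by (intro pos_homogeneous add_mem random_vector_inner_mem M_mem const_mem) auto
  also have "\<dots> = (g m v - v \<bullet> y) / a"
    using expectation_add_const[OF random_vector_inner_mem[OF M_mem], of v m "- (v \<bullet> y)"]
    by (simp add: g_def)
  finally show ?thesis .
qed

text \<open>As \<open>K\<close> is convex and nonempty, this is the \<open>j\<close>-fold Minkowski
  sum of \<open>K\<close>, with \<open>{0}\<close> for \<open>j = 0\<close>.\<close>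

definition scaled_K :: "nat \<Rightarrow> (real ^ 'd) set"
  where "scaled_K j = (\<lambda>y. real j *\<^sub>R y) ` K"

lemma scaled_K_Suc:
  assumes "p \<in> scaled_K j" "y \<in> K"
  shows "p + y \<in> scaled_K (Suc j)"
proof -
  obtain q where q: "q \<in> K" "p = real j *\<^sub>R q"
    using assms by (auto simp: scaled_K_def)
  have "(real j / Suc j) *\<^sub>R q + (1 / Suc j) *\<^sub>R y \<in> K"
    using convexD[OF convex_K q(1) assms(2), of "real j / Suc j" "1 / Suc j"]
    by (simp flip: add_divide_distrib)
  moreover have "p + y = real (Suc j) *\<^sub>R ((real j / Suc j) *\<^sub>R q + (1 / Suc j) *\<^sub>R y)"
    by (simp add: q(2) scaleR_add_right del: of_nat_Suc)
  ultimately show ?thesis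
    unfolding scaled_K_def by blast
qed

lemma K_nonempty: "K \<noteq> {}"
  using K_support[of 1 0] by auto

lemma compact_scaled_K: "compact (scaled_K j)"
  unfolding scaled_K_def by (intro compact_scaling compact_K)

text \<open>Let \<open>p\<close> be the point of \<open>scaled_K j\<close> nearest to
  \<open>z\<close> and let \<open>y\<close> nearly maximise the direction \<open>v = z - p\<close>
  over \<open>K\<close>. Then \<open>p + y\<close> competes in the next distance, which is thus at
  most the norm of \<open>v + (M m - y)\<close>. In the expansion of \<open>norm_Pair_add_le\<close>
  the linear term has expectation at most \<open>4 * C\<^sub>1 / sqrt m\<close> by the choice of
  \<open>y\<close>, and the remainder is controlled by the second moment.\<close>

lemma P_infdist_step:
  assumes s: "s > 0" and m: "m \<ge> 1" and R: "\<And>y. y \<in> K \<Longrightarrow> norm y \<le> R"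
  shows "P m (\<lambda>x. norm (s, infdist x (scaled_K (Suc j)))) z
    \<le> norm (s, infdist z (scaled_K j)) + (4 * C\<^sub>1 / sqrt m + 3 * (S\<^sub>2 + R\<^sup>2) / s)"
proof -
  have "closed (scaled_K j)" "scaled_K j \<noteq> {}"
    using compact_scaled_K compact_imp_closed K_nonempty by (auto simp: scaled_K_def)
  then obtain p where p: "p \<in> scaled_K j" "infdist z (scaled_K j) = dist z p"
    using infdist_attains_inf by blast
  define v where "v = z - p"
  define a where "a = norm (s, v)"
  have a: "a = norm (s, infdist z (scaled_K j))"
    using norm_Pair_norm[of s v] by (simp add: a_def p(2) dist_norm v_def)
  have a_pos: "a > 0" and va: "norm v \<le> a"
    using norm_Pair_ge[of s v] norm_snd_le[of v s] s by (auto simp: a_def)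
  obtain y where y: "y \<in> K" "g m v \<le> v \<bullet> y + norm v * (4 * C\<^sub>1 / sqrt m)"
    using K_support[OF m] by blast
  note mem = norm_Pair_M_mem[of s m y] inner_M_mem[of v m y a]
  have "norm (s, infdist (z + M m \<omega>) (scaled_K (Suc j)))
      \<le> (v \<bullet> (M m \<omega> - y) / a + 3 * (norm (s, M m \<omega> - y) - s)) + a" for \<omega>
  proof -
    have "infdist (z + M m \<omega>) (scaled_K (Suc j)) \<le> dist (z + M m \<omega>) (p + y)"
      by (intro infdist_le scaled_K_Suc p y)
    also have "\<dots> = norm (v + (M m \<omega> - y))"
      by (simp add: dist_norm v_def algebra_simps)
    finally have "norm (s, infdist (z + M m \<omega>) (scaled_K (Suc j))) \<le> norm (s, norm (v + (M m \<omega> - y)))"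
      by (intro norm_Pair_mono) (simp add: infdist_nonneg)
    also have "\<dots> \<le> a + v \<bullet> (M m \<omega> - y) / a + 3 * (norm (s, M m \<omega> - y) - s)"
      unfolding norm_Pair_norm a_def by (rule norm_Pair_add_le[OF s])
    finally show ?thesis by simp
  qed
  then have "P m (\<lambda>x. norm (s, infdist x (scaled_K (Suc j)))) z
      \<le> E (\<lambda>\<omega>. (v \<bullet> (M m \<omega> - y) / a + 3 * (norm (s, M m \<omega> - y) - s)) + a)"
    unfolding P_def
    by (intro mono P_mem[OF lipschitz_norm_Pair_infdist] add_mem scale_mem mem const_mem) auto
  also have "\<dots> = E (\<lambda>\<omega>. v \<bullet> (M m \<omega> - y) / a + 3 * (norm (s, M m \<omega> - y) - s)) + a"
    by (intro expectation_add_const add_mem scale_mem mem)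
  also have "\<dots> \<le> E (\<lambda>\<omega>. v \<bullet> (M m \<omega> - y) / a) + E (\<lambda>\<omega>. 3 * (norm (s, M m \<omega> - y) - s)) + a"
    by (intro add_right_mono subadditive scale_mem mem)
  also have "E (\<lambda>\<omega>. v \<bullet> (M m \<omega> - y) / a) \<le> 4 * C\<^sub>1 / sqrt m"
  proof -
    have "g m v - v \<bullet> y \<le> norm v * (4 * C\<^sub>1 / sqrt m)"
      using y by simp
    also have "\<dots> \<le> a * (4 * C\<^sub>1 / sqrt m)"
      using va C\<^sub>1_nonneg by (intro mult_right_mono) auto
    finally show ?thesis
      unfolding expectation_inner_M[OF a_pos] using a_pos by (simp add: pos_divide_le_eq mult.commute)
  qed
  also have "E (\<lambda>\<omega>. 3 * (norm (s, M m \<omega> - y) - s)) \<le> 3 * (S\<^sub>2 + R\<^sup>2) / s"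
  proof -
    have "E (\<lambda>\<omega>. 3 * (norm (s, M m \<omega> - y) - s)) = 3 * E (\<lambda>\<omega>. norm (s, M m \<omega> - y) - s)"
      by (intro pos_homogeneous mem) auto
    also have "\<dots> \<le> 3 * ((S\<^sub>2 + (norm y)\<^sup>2) / s)"
      by (intro mult_left_mono expectation_norm_Pair_M_le s m) auto
    also have "\<dots> \<le> 3 * ((S\<^sub>2 + R\<^sup>2) / s)"
      using s R[OF y(1)] by (intro mult_left_mono divide_right_mono add_left_mono power_mono) auto
    finally show ?thesis by simp
  qed
  finally show ?thesis by (simp add: a)
qed

text \<open>The same expansion with the fixed point \<open>y\<close>: since \<open>y\<close> lies in
  every mean set, \<open>- v \<bullet> (M m - y)\<close> has nonnegative upper expectation. Moving
  the remainder \<open>h\<close> to the side of \<open>U\<close> turns subadditivity into a lower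
  bound for \<open>E U\<close>.\<close>

lemma P_point_step:
  assumes s: "s > 0" and m: "m \<ge> 1" and y: "y \<in> K" and R: "norm y \<le> R"
  shows "- norm (s, z - real j *\<^sub>R y) - 3 * (S\<^sub>2 + R\<^sup>2) / s
    \<le> P m (\<lambda>x. - norm (s, x - real (Suc j) *\<^sub>R y)) z"
proof -
  define v where "v = z - real j *\<^sub>R y"
  define a where "a = norm (s, v)"
  have a_pos: "a > 0"
    unfolding a_def by (rule less_le_trans[OF s norm_Pair_ge])
  note mem = norm_Pair_M_mem[of s m y] inner_M_mem[of "- v" m y a]
  define W where "W = (\<lambda>\<omega>. (- v) \<bullet> (M m \<omega> - y) / a)"
  define h where "h = (\<lambda>\<omega>. 3 * (norm (s, M m \<omega> - y) - s))"
  define U where "U = (\<lambda>\<omega>. - norm (s, (z + M m \<omega>) - real (Suc j) *\<^sub>R y))"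
  have W: "W \<in> H" and h: "h \<in> H"
    unfolding W_def h_def by (intro mem scale_mem)+
  have U: "U \<in> H"
    unfolding U_def by (rule P_mem[OF lipschitz_uminus[OF lipschitz_norm_Pair]])
  have "W \<omega> + - a \<le> U \<omega> + h \<omega>" for \<omega>
  proof -
    have "(z + M m \<omega>) - real (Suc j) *\<^sub>R y = v + (M m \<omega> - y)"
      by (simp add: v_def algebra_simps)
    then have "U \<omega> = - norm (s, v + (M m \<omega> - y))"
      by (simp only: U_def)
    then show ?thesis
      using norm_Pair_add_le[OF s, of v "M m \<omega> - y"] by (simp add: W_def h_def a_def)
  qed
  then have "E (\<lambda>\<omega>. W \<omega> + - a) \<le> E (\<lambda>\<omega>. U \<omega> + h \<omega>)"
    by (intro mono add_mem W U h const_mem) auto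
  also have "\<dots> \<le> E U + E h"
    by (rule subadditive[OF U h])
  finally have "E W - a \<le> E U + E h"
    using expectation_add_const[OF W, of "- a"] by simp
  moreover have "0 \<le> E W"
    using inner_K_le[OF y m, of "- v"] a_pos unfolding W_def expectation_inner_M[OF a_pos] by simp
  moreover have "E h \<le> 3 * (S\<^sub>2 + R\<^sup>2) / s"
  proof -
    have "E h = 3 * E (\<lambda>\<omega>. norm (s, M m \<omega> - y) - s)"
      unfolding h_def by (intro pos_homogeneous mem) auto
    also have "\<dots> \<le> 3 * ((S\<^sub>2 + (norm y)\<^sup>2) / s)"
      by (intro mult_left_mono expectation_norm_Pair_M_le s m) auto
    also have "\<dots> \<le> 3 * ((S\<^sub>2 + R\<^sup>2) / s)"
      using s R by (intro mult_left_mono divide_right_mono add_left_mono power_mono) auto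
    finally show ?thesis by simp
  qed
  moreover have "E U = P m (\<lambda>x. - norm (s, x - real (Suc j) *\<^sub>R y)) z"
    by (simp add: U_def P_def)
  ultimately show ?thesis by (simp add: a_def v_def)
qed

text \<open>By the Lipschitz bound, \<open>\<phi>\<^sub>N\<close> lies below \<open>\<phi> y\<close>
  plus \<open>\<kappa>\<close> times the distance to \<open>scaled_K N\<close>, and above
  \<open>\<phi> y\<close> minus \<open>\<kappa>\<close> times the distance to \<open>N\<close> times
  \<open>y\<close>. Both distances are replaced by their smoothings and iterated \<open>N\<close>
  times; the start at 0 contributes \<open>s\<close>, each step \<open>\<eta>\<close>. The factor
  \<open>CARD('d)\<close> converts \<open>norm1\<close> to the Euclidean norm.\<close>

lemma independent_block_lln:
  fixes l s :: real
  assumes \<phi>: "lipschitz_wrt dist_Rd l \<phi>" and l: "l > 0"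
    and s: "s > 0" and m: "m \<ge> 1" and N: "N \<ge> 1"
    and R: "\<And>y. y \<in> K \<Longrightarrow> norm y \<le> R"
    and y: "y \<in> K" and max: "\<And>x. x \<in> K \<Longrightarrow> \<phi> x \<le> \<phi> y"
  shows "\<bar>(P m ^^ N) (\<lambda>x. \<phi> ((1 / N) *\<^sub>R x)) 0 - \<phi> y\<bar>
    \<le> l * CARD('d) * (s / N + (4 * C\<^sub>1 / sqrt m + 3 * (S\<^sub>2 + R\<^sup>2) / s))"
proof -
  define \<eta> where "\<eta> = 4 * C\<^sub>1 / sqrt m + 3 * (S\<^sub>2 + R\<^sup>2) / s"
  define \<kappa> where "\<kappa> = l * CARD('d) / N"
  define \<phi>\<^sub>N where "\<phi>\<^sub>N = (\<lambda>x. \<phi> ((1 / N) *\<^sub>R x))"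
  have \<kappa>: "\<kappa> \<ge> 0" using l by (simp add: \<kappa>_def)
  have lip: "lipschitz_wrt dist_Rd (l * \<bar>1 / N\<bar>) \<phi>\<^sub>N"
    using lipschitz_affine[OF \<phi>, of "1 / N" 0] by (simp add: \<phi>\<^sub>N_def)
  have diff: "\<bar>\<phi>\<^sub>N x - \<phi> q\<bar> \<le> \<kappa> * norm (x - real N *\<^sub>R q)" for x q
  proof -
    have "(1 / N) *\<^sub>R x - q = (1 / N) *\<^sub>R (x - real N *\<^sub>R q)"
      using N by (simp add: scaleR_diff_right)
    then have "\<bar>\<phi>\<^sub>N x - \<phi> q\<bar> \<le> l * ((1 / N) * norm1 (x - real N *\<^sub>R q))"
      using lipschitz_dist_RdD[OF \<phi>, of "(1 / N) *\<^sub>R x" q] by (simp add: \<phi>\<^sub>N_def)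
    also have "\<dots> \<le> l * ((1 / N) * (CARD('d) * norm (x - real N *\<^sub>R q)))"
      using l by (intro mult_left_mono norm1_le_norm) auto
    finally show ?thesis by (simp add: \<kappa>_def)
  qed
  have \<kappa>\<eta>: "\<kappa> * (s + N * \<eta>) = l * CARD('d) * (s / N + \<eta>)"
    using N by (simp add: \<kappa>_def field_simps)
  have "(P m ^^ N) \<phi>\<^sub>N 0 \<le> \<phi> y + \<kappa> * (s + N * \<eta>)"
  proof -
    define F where "F = (\<lambda>j x. norm (s, infdist x (scaled_K j)))"
    have F: "lipschitz_wrt dist_Rd 1 (F j)" for j
      unfolding F_def by (rule lipschitz_norm_Pair_infdist)
    have step: "P m (F (Suc j)) z \<le> F j z + \<eta>" for j z
      unfolding F_def \<eta>_def by (rule P_infdist_step[OF s m R])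
    have "\<phi>\<^sub>N x \<le> \<kappa> * F N x + \<phi> y" for x
    proof -
      have "closed (scaled_K N)" "scaled_K N \<noteq> {}"
        using compact_scaled_K compact_imp_closed K_nonempty by (auto simp: scaled_K_def)
      then obtain p where p: "p \<in> scaled_K N" "infdist x (scaled_K N) = dist x p"
        using infdist_attains_inf by blast
      then obtain q where q: "q \<in> K" "p = real N *\<^sub>R q"
        by (auto simp: scaled_K_def)
      have "\<phi>\<^sub>N x \<le> \<phi> q + \<kappa> * norm (x - p)"
        using diff[of x q] q by simp
      also have "\<dots> \<le> \<phi> y + \<kappa> * F N x"
        using max[OF q(1)] \<kappa> norm_snd_le[of "infdist x (scaled_K N)" s]
        by (intro add_mono mult_left_mono) (auto simp: F_def p(2) dist_norm)
      finally show ?thesis by simp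
    qed
    then have "(P m ^^ N) \<phi>\<^sub>N 0 \<le> (P m ^^ N) (\<lambda>x. \<kappa> * F N x + \<phi> y) 0"
      by (intro P_funpow_mono[OF lip lipschitz_add_const[OF lipschitz_scale[OF F \<kappa>]]])
    also have "\<dots> = \<kappa> * (P m ^^ N) (F N) 0 + \<phi> y"
      by (simp add: P_funpow_add_const[OF lipschitz_scale[OF F \<kappa>]] P_funpow_scale[OF F \<kappa>])
    also have "\<dots> \<le> \<kappa> * (F 0 0 + N * \<eta>) + \<phi> y"
      using \<kappa> by (intro add_right_mono mult_left_mono P_funpow_le[where F = F, OF F step])
    also have "F 0 0 = s"
    proof -
      have "scaled_K 0 = {0}"
        using K_nonempty by (auto simp: scaled_K_def)
      then show ?thesis using s by (simp add: F_def norm_Pair)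
    qed
    finally show ?thesis by simp
  qed
  moreover have "\<phi> y - \<kappa> * (s + N * \<eta>) \<le> (P m ^^ N) \<phi>\<^sub>N 0"
  proof -
    define F where "F = (\<lambda>j x. - norm (s, x - real j *\<^sub>R y))"
    have F: "lipschitz_wrt dist_Rd 1 (F j)" for j
      unfolding F_def by (rule lipschitz_uminus[OF lipschitz_norm_Pair])
    have step: "F j z - \<eta> \<le> P m (F (Suc j)) z" for j z
    proof -
      have "0 \<le> 4 * C\<^sub>1 / sqrt m"
        using C\<^sub>1_nonneg by simp
      with P_point_step[OF s m y R[OF y], of z j] show ?thesis
        by (simp add: F_def \<eta>_def)
    qed
    have "\<phi> y - \<kappa> * (s + N * \<eta>) = \<kappa> * (F 0 0 - N * \<eta>) + \<phi> y"
      using s by (simp add: F_def norm_Pair algebra_simps)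
    also have "\<dots> \<le> \<kappa> * (P m ^^ N) (F N) 0 + \<phi> y"
      using \<kappa> by (intro add_right_mono mult_left_mono P_funpow_ge[where F = F, OF F step])
    also have "\<dots> = (P m ^^ N) (\<lambda>x. \<kappa> * F N x + \<phi> y) 0"
      by (simp add: P_funpow_add_const[OF lipschitz_scale[OF F \<kappa>]] P_funpow_scale[OF F \<kappa>])
    also have "\<dots> \<le> (P m ^^ N) \<phi>\<^sub>N 0"
    proof (intro P_funpow_mono[OF lipschitz_add_const[OF lipschitz_scale[OF F \<kappa>]] lip])
      fix x
      have "\<kappa> * norm (x - real N *\<^sub>R y) \<le> \<kappa> * norm (s, x - real N *\<^sub>R y)"
        using \<kappa> norm_snd_le[of "x - real N *\<^sub>R y" s] by (intro mult_left_mono) auto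
      then show "\<kappa> * F N x + \<phi> y \<le> \<phi>\<^sub>N x"
        using diff[of x y] by (simp add: F_def)
    qed
    finally show ?thesis .
  qed
  ultimately show ?thesis
    unfolding \<kappa>\<eta> by (simp add: \<phi>\<^sub>N_def \<eta>_def abs_le_iff algebra_simps)
qed

end

subsection \<open>The rate of convergence\<close>

context mixing_sequence
begin

lemma expectation_norm1_M_le: "n \<ge> 1 \<Longrightarrow> E (\<lambda>\<omega>. norm1 (M n \<omega>)) \<le> A"
  using expectation_norm1_sum_le[of "{1..n}" "\<lambda>_. 1 / n"]
  by (auto simp: block_mean_def scaleR_sum_right)

text \<open>Comparison with the constant vector \<open>y\<close>; it settles the small
  \<open>n\<close> whose fourth root is below 2.\<close>

lemma coarse_bound:
  assumes \<phi>: "lipschitz_wrt dist_Rd l \<phi>" and l: "l \<ge> 0" and n: "n \<ge> 1"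
  shows "\<bar>E (\<lambda>\<omega>. \<phi> (M n \<omega>)) - \<phi> y\<bar> \<le> l * (A + norm1 y)"
proof -
  have y: "(\<lambda>_. y) \<in> random_vectors H"
    by (simp add: random_vectors_def const_mem)
  have "\<bar>E (\<lambda>\<omega>. \<phi> (M n \<omega>)) - E (\<lambda>_. \<phi> y)\<bar> \<le> l * E (\<lambda>\<omega>. norm1 (M n \<omega> - y))"
    by (rule expectation_lipschitz_diff_le[OF \<phi> l M_mem y])
  also have "\<dots> \<le> l * E (\<lambda>\<omega>. norm1 (M n \<omega>) + norm1 y)"
  proof (intro mult_left_mono mono l random_vector_norm1_mem random_vector_diff_mem M_mem y
      add_mem const_mem allI)
    show "norm1 (M n \<omega> - y) \<le> norm1 (M n \<omega>) + norm1 y" for \<omega>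
      using norm1_triangle[of "M n \<omega>" "- y"] by simp
  qed
  also have "\<dots> = l * (E (\<lambda>\<omega>. norm1 (M n \<omega>)) + norm1 y)"
    by (simp only: expectation_add_const[OF random_vector_norm1_mem[OF M_mem]])
  also have "\<dots> \<le> l * (A + norm1 y)"
    using expectation_norm1_M_le[OF n] l by (intro mult_left_mono) auto
  finally show ?thesis by (simp add: const)
qed

text \<open>
  With \<open>r\<close> close to the fourth root of \<open>n\<close>, we use \<open>r^2\<close> blocks of length \<open>r^2 - r\<close> separated by gaps
  of length \<open>r\<close>: dropping the gaps, replacing the limit mean set by that of a single block, and the
  fluctuations of \<open>r^2\<close> blocks all cost \<open>O (1 / r)\<close>.
\<close>

lemma block_bound:
  fixes r n :: nat
  assumes \<phi>: "lipschitz_wrt dist_Rd l \<phi>" and l: "l > 0"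
    and r: "r \<ge> 2" "r ^ 4 \<le> n" "n \<le> (r + 1) ^ 4"
    and R: "\<And>y. y \<in> K \<Longrightarrow> norm y \<le> R"
    and y: "y \<in> K" and max: "\<And>x. x \<in> K \<Longrightarrow> \<phi> x \<le> \<phi> y"
  shows "\<bar>E (\<lambda>\<omega>. \<phi> (M n \<omega>)) - \<phi> y\<bar>
    \<le> l * (32 * A + c * (3 / \<alpha>) ^ 3 + CARD('d) * (1 + 8 * C\<^sub>1 + 3 * (S\<^sub>2 + R\<^sup>2))) / r"
proof -
  define m where "m = r\<^sup>2 - r"
  define N where "N = r\<^sup>2"
  define B where "B = blocks m r N"
  have mr: "m + r = r\<^sup>2"
    using r by (simp add: m_def power2_eq_square)
  have "r * 2 \<le> r * r"
    using r by (intro mult_le_mono2) simp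
  then have "r \<le> m" "r\<^sup>2 \<le> m * 2"
    using mr unfolding power2_eq_square by linarith+
  then have m: "m \<ge> 1" and rm: "(real r)\<^sup>2 \<le> real m * 2" and N: "N \<ge> 1"
    using r(1) of_nat_mono[of "r\<^sup>2" "m * 2", where 'a = real] by (simp_all add: N_def)
  have Nr: "real N = (real r)\<^sup>2" and r_pos: "real r \<ge> 2"
    using r by (simp_all add: N_def)
  have "N * (m + r) = r ^ 4"
    by (simp add: mr N_def flip: power_add)
  then have "1 \<le> u \<and> u \<le> n" if "u \<in> B" for u
    using blocks_le[of u m r N] that r(2) by (simp add: B_def)
  moreover have card: "card B = N * m"
    unfolding B_def by (rule card_blocks)
  moreover have "card B \<noteq> 0"
    using card m N by simp
  ultimately have B: "B \<subseteq> {1..n}" "B \<noteq> {}"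
    by auto
  \<comment> \<open>The deleted indices are the gaps and those beyond \<open>r ^ 4\<close>; together
    they number \<open>O (r ^ 3)\<close> out of at least \<open>r ^ 4\<close>.\<close>
  have "real n - card B \<le> (real r + 1) ^ 4 - (real r)\<^sup>2 * ((real r)\<^sup>2 - real r)"
  proof -
    have "real n \<le> real ((r + 1) ^ 4)"
      using r(3) by (rule of_nat_mono)
    moreover have "real m = (real r)\<^sup>2 - real r"
      using arg_cong[OF mr, of real] by simp
    ultimately show ?thesis
      by (simp add: card Nr add.commute)
  qed
  also have "\<dots> = 5 * real r ^ 3 + 6 * (real r)\<^sup>2 + 4 * real r + 1"
    by (simp add: power2_eq_square power3_eq_cube power4_eq_xxxx algebra_simps)
  also have "\<dots> \<le> 16 * real r ^ 3"
  proof -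
    have "1 \<le> real r ^ 3" "real r \<le> real r ^ 3" "(real r)\<^sup>2 \<le> real r ^ 3"
      using r_pos power_increasing[of 1 3 "real r"] power_increasing[of 2 3 "real r"]
        one_le_power[of "real r" 3] by (simp_all only: power_one_right)
    then show ?thesis by linarith
  qed
  finally have "2 * A * (real n - card B) / n \<le> 2 * A * (16 * real r ^ 3) / real r ^ 4"
    using A_nonneg r_pos r(2) by (intro frac_le mult_left_mono) (auto simp flip: of_nat_power)
  also have "\<dots> = 32 * A / r"
    using r_pos by (simp add: power3_eq_cube power4_eq_xxxx)
  finally have "l * (2 * A * (real n - card B) / n) \<le> l * (32 * A / r)"
    using l by (intro mult_left_mono) auto
  then have 1: "\<bar>E (\<lambda>\<omega>. \<phi> (M n \<omega>)) - E (\<lambda>\<omega>. \<phi> (block_mean X B \<omega>))\<bar> \<le> l * (32 * A / r)"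
    using block_mean_compare[OF \<phi> _ B] l by simp
  define G where "G = (\<lambda>x. \<phi> ((1 / N) *\<^sub>R x))"
  have "lipschitz_wrt dist_Rd (l / N) G"
    using lipschitz_affine[OF \<phi>, of "1 / N" 0] by (simp add: G_def)
  from decoupling[OF m this, of N r]
  have "\<bar>E (\<lambda>\<omega>. \<phi> (block_mean X B \<omega>)) - (P m ^^ N) G 0\<bar> \<le> c * (l / N) * (real N)\<^sup>2 * exp (- \<alpha> * r)"
    using N l by (simp add: G_def B_def)
  also have "\<dots> = l * c * (real r)\<^sup>2 * exp (- (\<alpha> * r))"
    using Nr r_pos by (simp add: power2_eq_square)
  \<comment> \<open>The cubic bound on the exponential outweighs the factor \<open>r^2\<close>, the
    number of blocks, and leaves \<open>1 / r\<close>.\<close>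
  also have "\<dots> \<le> l * c * (real r)\<^sup>2 * (3 / (\<alpha> * r)) ^ 3"
    using exp_minus_le_inverse_power[of "\<alpha> * r" 2] l c_pos \<alpha>_pos r_pos
    by (intro mult_left_mono) (auto simp: numeral_3_eq_3)
  also have "\<dots> = l * (c * (3 / \<alpha>) ^ 3 / r)"
    using r_pos by (simp add: power_divide power_mult_distrib power2_eq_square power3_eq_cube)
  finally have 2: "\<bar>E (\<lambda>\<omega>. \<phi> (block_mean X B \<omega>)) - (P m ^^ N) G 0\<bar> \<le> l * (c * (3 / \<alpha>) ^ 3 / r)" .
  have "real r / 2 \<le> sqrt m"
    using rm by (intro real_le_rsqrt) (simp add: power_divide)
  then have "4 * C\<^sub>1 / sqrt m \<le> 4 * C\<^sub>1 / (r / 2)"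
    using C\<^sub>1_nonneg r_pos m by (intro divide_left_mono mult_pos_pos) auto
  \<comment> \<open>The smoothing scale is \<open>s = r\<close>, which balances \<open>s / N\<close>
    against \<open>1 / s\<close>.\<close>
  then have "real r / N + (4 * C\<^sub>1 / sqrt m + 3 * (S\<^sub>2 + R\<^sup>2) / r)
      \<le> 1 / r + (8 * C\<^sub>1 / r + 3 * (S\<^sub>2 + R\<^sup>2) / r)"
    using r_pos by (simp add: Nr power2_eq_square)
  then have "l * CARD('d) * (real r / N + (4 * C\<^sub>1 / sqrt m + 3 * (S\<^sub>2 + R\<^sup>2) / r))
      \<le> l * CARD('d) * (1 / r + (8 * C\<^sub>1 / r + 3 * (S\<^sub>2 + R\<^sup>2) / r))"
    using l by (intro mult_left_mono) auto
  then have 3: "\<bar>(P m ^^ N) G 0 - \<phi> y\<bar> \<le> l * CARD('d) * (1 / r + (8 * C\<^sub>1 / r + 3 * (S\<^sub>2 + R\<^sup>2) / r))"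
    using independent_block_lln[OF \<phi> l _ m N R y max, of r] r_pos unfolding G_def by linarith
  have "l * (32 * A / r) + l * (c * (3 / \<alpha>) ^ 3 / r)
      + l * CARD('d) * (1 / r + (8 * C\<^sub>1 / r + 3 * (S\<^sub>2 + R\<^sup>2) / r))
    = l * (32 * A + c * (3 / \<alpha>) ^ 3 + CARD('d) * (1 + 8 * C\<^sub>1 + 3 * (S\<^sub>2 + R\<^sup>2))) / r"
    by (simp add: add_divide_distrib distrib_left)
  with 1 2 3 show ?thesis by linarith
qed

text \<open>With \<open>r\<close> the integer part of the fourth root of \<open>n\<close>,
  \<open>C\<^sub>2\<close> comes from the block scheme for \<open>r \<ge> 2\<close> and
  \<open>C\<^sub>3\<close> from \<open>coarse_bound\<close> for \<open>r = 1\<close>. Both depend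
  only on the sequence, through moments, mixing data, dimension and a radius \<open>R\<close> of
  \<open>K\<close>. The maximum exists by compactness of \<open>K\<close>.\<close>

lemma convergence_rate:
  "\<exists>C>0. \<forall>\<phi> l. l > 0 \<and> lipschitz_wrt dist_Rd l \<phi> \<longrightarrow>
    (\<exists>u. is_max_over \<phi> K u \<and>
      (\<forall>n\<ge>1. \<bar>E (\<lambda>\<omega>. \<phi> (M n \<omega>)) - u\<bar> \<le> C * l * real n powr (- 1 / 4)))"
proof -
  obtain R where R: "R > 0" "\<And>y. y \<in> K \<Longrightarrow> norm y \<le> R"
    using compact_imp_bounded[OF compact_K] bounded_pos by blast
  define C\<^sub>2 where "C\<^sub>2 = 32 * A + c * (3 / \<alpha>) ^ 3 + CARD('d) * (1 + 8 * C\<^sub>1 + 3 * (S\<^sub>2 + R\<^sup>2))"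
  define C\<^sub>3 where "C\<^sub>3 = A + CARD('d) * R"
  have "0 \<le> C\<^sub>2" and "0 < C\<^sub>3"
    using A_nonneg C\<^sub>1_nonneg S\<^sub>2_nonneg c_pos \<alpha>_pos R(1)
    by (auto simp: C\<^sub>2_def C\<^sub>3_def intro!: add_nonneg_nonneg add_nonneg_pos)
  show ?thesis
  proof (rule exI[of _ "2 * (C\<^sub>2 + C\<^sub>3)"], intro conjI allI impI)
    show "2 * (C\<^sub>2 + C\<^sub>3) > 0"
      using \<open>0 \<le> C\<^sub>2\<close> \<open>0 < C\<^sub>3\<close> by simp
    fix \<phi> :: "real ^ 'd \<Rightarrow> real" and l
    assume "l > 0 \<and> lipschitz_wrt dist_Rd l \<phi>"
    then have l: "l > 0" and \<phi>: "lipschitz_wrt dist_Rd l \<phi>" by auto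
    have "continuous_on K \<phi>"
    proof (rule continuous_on_subset[OF lipschitz_on_continuous_on])
      show "(l * CARD('d))-lipschitz_on UNIV \<phi>"
      proof (rule lipschitz_onI)
        fix x z
        have "\<bar>\<phi> x - \<phi> z\<bar> \<le> l * (CARD('d) * norm (x - z))"
          using lipschitz_dist_RdD[OF \<phi>, of x z] mult_left_mono[OF norm1_le_norm[of "x - z"] less_imp_le[OF l]]
          by (rule order_trans)
        then show "dist (\<phi> x) (\<phi> z) \<le> l * CARD('d) * dist x z"
          by (simp add: dist_norm mult.assoc)
      qed (use l in simp)
    qed simp
    then obtain y where y: "y \<in> K" and max: "\<And>x. x \<in> K \<Longrightarrow> \<phi> x \<le> \<phi> y"
      using continuous_attains_sup[OF compact_K K_nonempty] by blast
    show "\<exists>u. is_max_over \<phi> K u \<and>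
      (\<forall>n\<ge>1. \<bar>E (\<lambda>\<omega>. \<phi> (M n \<omega>)) - u\<bar> \<le> 2 * (C\<^sub>2 + C\<^sub>3) * l * real n powr (- 1 / 4))"
    proof (intro exI[of _ "\<phi> y"] conjI allI impI)
      show "is_max_over \<phi> K (\<phi> y)"
        using y max by (auto simp: is_max_over_def)
      fix n :: nat assume n: "n \<ge> 1"
      define x where "x = real n powr (1 / 4)"
      define r where "r = nat \<lfloor>x\<rfloor>"
      have x: "x \<ge> 1" "x ^ 4 = real n" "real n powr (- 1 / 4) = 1 / x"
        using n ge_one_powr_ge_zero[of "real n" "1 / 4"] powr_power[of "real n" "1 / 4" 4]
          powr_minus_divide[of "real n" "1 / 4"]
        by (simp_all add: x_def)
      have r: "real r \<le> x" "x \<le> real (r + 1)" "r \<ge> 1"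
        using x(1) unfolding r_def by (linarith, linarith, simp add: le_nat_floor)
      have "real (r ^ 4) \<le> real n" "real n \<le> real ((r + 1) ^ 4)"
        using power_mono[OF r(1), of 4] power_mono[OF r(2), of 4] x by auto
      then have rn: "r ^ 4 \<le> n" "n \<le> (r + 1) ^ 4"
        by (simp_all only: of_nat_le_iff)
      \<comment> \<open>Rounding loses at most a factor 2, since
        \<open>x \<le> r + 1 \<le> 2 * r\<close>.\<close>
      have inv: "1 / r \<le> 2 / x"
        using r x by (simp add: field_simps)
      show "\<bar>E (\<lambda>\<omega>. \<phi> (M n \<omega>)) - \<phi> y\<bar> \<le> 2 * (C\<^sub>2 + C\<^sub>3) * l * real n powr (- 1 / 4)"
      proof (cases "r \<ge> 2")
        case True
        have "\<bar>E (\<lambda>\<omega>. \<phi> (M n \<omega>)) - \<phi> y\<bar> \<le> l * C\<^sub>2 * (1 / r)"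
          using block_bound[OF \<phi> l True rn R(2) y max] by (simp add: C\<^sub>2_def)
        also have "\<dots> \<le> l * (C\<^sub>2 + C\<^sub>3) * (2 / x)"
          using l \<open>0 \<le> C\<^sub>2\<close> \<open>0 < C\<^sub>3\<close> x inv by (intro mult_mono) auto
        finally show ?thesis
          unfolding x(3) by (simp add: algebra_simps)
      next
        case False
        then have "1 \<le> 2 / x" using r x by simp
        have "norm1 y \<le> CARD('d) * norm y"
          by (rule norm1_le_norm)
        also have "\<dots> \<le> CARD('d) * R"
          using R(2)[OF y] by (intro mult_left_mono) auto
        finally have "l * (A + norm1 y) \<le> l * C\<^sub>3"
          using l by (intro mult_left_mono) (simp_all add: C\<^sub>3_def)
        with coarse_bound[OF \<phi> less_imp_le[OF l] n, of y]
        have "\<bar>E (\<lambda>\<omega>. \<phi> (M n \<omega>)) - \<phi> y\<bar> \<le> l * C\<^sub>3 * 1"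
          unfolding mult_1_right by (rule order_trans)
        also have "\<dots> \<le> l * (C\<^sub>2 + C\<^sub>3) * (2 / x)"
          using \<open>1 \<le> 2 / x\<close> l \<open>0 \<le> C\<^sub>2\<close> \<open>0 < C\<^sub>3\<close> by (intro mult_mono) auto
        finally show ?thesis
          unfolding x(3) by (simp add: algebra_simps)
      qed
    qed
  qed
qed

end

theorem theorem1p4:
  fixes H :: "('w \<Rightarrow> real) set"
    and Ehat :: "('w \<Rightarrow> real) \<Rightarrow> real"
    and X :: "nat \<Rightarrow> 'w \<Rightarrow> real ^ 'd"
    and \<alpha> :: real
  assumes "sublinear_expectation H Ehat"
    and "\<And>k. k \<ge> 1 \<Longrightarrow> X k \<in> random_vectors H"
    and "stationary Ehat X"
    and "\<alpha> > 0"
    and "alpha_mixing Ehat \<alpha> X"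
    and "(\<lambda>\<omega>. (norm1 (X 1 \<omega>))\<^sup>2) \<in> H"
  shows "\<forall>\<delta>>0. \<exists>C>0. \<forall>\<phi> l. l > 0 \<and> lipschitz_wrt dist_Rd l \<phi> \<longrightarrow>
    (\<exists>m. is_max_over \<phi> (limit_mean_set H Ehat X) m \<and>
      (\<forall>n\<ge>1. \<bar>Ehat (\<lambda>\<omega>. \<phi> ((1 / real n) *\<^sub>R (\<Sum>k=1..n. X k \<omega>))) - m\<bar>
        \<le> C * l * real n powr (- 1 / 4 + \<delta>)))"
proof -
  obtain c where c: "c > 0" and mixing: "\<forall>\<Lambda>\<^sub>1 \<Lambda>\<^sub>2. finite \<Lambda>\<^sub>1 \<and> \<Lambda>\<^sub>1 \<noteq> {} \<and> \<Lambda>\<^sub>1 \<subseteq> {1..} \<and>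
        finite \<Lambda>\<^sub>2 \<and> \<Lambda>\<^sub>2 \<noteq> {} \<and> \<Lambda>\<^sub>2 \<subseteq> {1..} \<and> Max \<Lambda>\<^sub>1 \<le> Min \<Lambda>\<^sub>2 \<longrightarrow>
      (\<forall>\<phi> l. l > 0 \<and> lipschitz_wrt dist_R2d l \<phi> \<longrightarrow>
        \<bar>Ehat (\<lambda>\<omega>. \<phi> (block_mean X \<Lambda>\<^sub>1 \<omega>, block_mean X \<Lambda>\<^sub>2 \<omega>))
          - Ehat (\<lambda>\<omega>. Ehat (\<lambda>\<omega>'. \<phi> (block_mean X \<Lambda>\<^sub>1 \<omega>, block_mean X \<Lambda>\<^sub>2 \<omega>')))\<bar>
        \<le> c * l * exp (- \<alpha> * \<bar>real (Min \<Lambda>\<^sub>2) - real (Max \<Lambda>\<^sub>1)\<bar>))"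
    using assms(5) unfolding alpha_mixing_def by (elim exE conjE) (rule that)
  interpret sublinear_expectation H Ehat by fact
  interpret mixing_sequence H Ehat X \<alpha> c
    by unfold_locales (fact assms c mixing)+
  obtain C where C: "C > 0" and rate: "\<And>\<phi> l. l > 0 \<and> lipschitz_wrt dist_Rd l \<phi> \<Longrightarrow>
      \<exists>u. is_max_over \<phi> K u \<and>
        (\<forall>n\<ge>1. \<bar>Ehat (\<lambda>\<omega>. \<phi> (M n \<omega>)) - u\<bar> \<le> C * l * real n powr (- 1 / 4))"
    using convergence_rate by blast
  \<comment> \<open>The rate holds already with exponent \<open>- 1 / 4\<close>, so the same
    \<open>C\<close> serves every \<open>\<delta>\<close>: for \<open>n \<ge> 1\<close> a larger
    exponent only weakens the bound.\<close>
  show ?thesis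
  proof (intro allI impI, rule exI[of _ C], intro conjI C allI impI)
    fix \<delta> l :: real and \<phi> :: "real ^ 'd \<Rightarrow> real"
    assume \<delta>: "\<delta> > 0" and \<phi>: "l > 0 \<and> lipschitz_wrt dist_Rd l \<phi>"
    obtain u where u: "is_max_over \<phi> K u"
      and rate: "\<And>n. n \<ge> 1 \<Longrightarrow> \<bar>Ehat (\<lambda>\<omega>. \<phi> (M n \<omega>)) - u\<bar> \<le> C * l * real n powr (- 1 / 4)"
      using rate[OF \<phi>] by blast
    show "\<exists>m. is_max_over \<phi> (limit_mean_set H Ehat X) m \<and>
      (\<forall>n\<ge>1. \<bar>Ehat (\<lambda>\<omega>. \<phi> ((1 / real n) *\<^sub>R (\<Sum>k=1..n. X k \<omega>))) - m\<bar>
        \<le> C * l * real n powr (- 1 / 4 + \<delta>))"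
    proof (intro exI[of _ u] conjI allI impI)
      show "is_max_over \<phi> (limit_mean_set H Ehat X) u"
        using u by (simp add: K_def)
      fix n :: nat assume n: "n \<ge> 1"
      have "\<bar>Ehat (\<lambda>\<omega>. \<phi> ((1 / real n) *\<^sub>R (\<Sum>k=1..n. X k \<omega>))) - u\<bar> \<le> C * l * real n powr (- 1 / 4)"
        using rate[OF n] by (simp add: block_mean_def)
      also have "\<dots> \<le> C * l * real n powr (- 1 / 4 + \<delta>)"
        using n C \<phi> \<delta> by (intro mult_left_mono powr_mono) auto
      finally show "\<bar>Ehat (\<lambda>\<omega>. \<phi> ((1 / real n) *\<^sub>R (\<Sum>k=1..n. X k \<omega>))) - u\<bar>
        \<le> C * l * real n powr (- 1 / 4 + \<delta>)" .
    qed
  qed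
qed

end
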